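(* Assume that the objective function $f(\rho)=\operatorname{Tr}[\rho\,\Omega(\rho)]$ is convex and differentiable on $\mathcal M$, and let $\rho^*\in\mathcal M_{++}$ be an AB fixed point, i.e. $\mathcal T_{AB}(\rho^* )=\rho^*$. Then the following statements are equivalent: (c1) $\rho^*$ is a global minimizer of $f$ over $\mathcal M$; (c2) $\rho^*$ is a fixed point of the mirror-descent map, i.e. $\mathcal T_{MD}(\rho^* )=\rho^*$; (c3) $\Omega(\rho^* )-\nabla f(\rho^* )\in N_{\mathcal M}$.
   Context: $\mathcal H$ is a finite-dimensional complex Hilbert space, $\mathcal B(\mathcal H)$ the real space of Hermitian operators with inner product $\langle X,Y\rangle=\operatorname{Tr}(XY)$, $\mathcal S(\mathcal H)$ the set of density operators. $H_1,\dots,H_k\in\mathcal B(\mathcal H)$ and $c\in\mathbb R^k$ are given, with $\{I,H_1,\dots,H_k\}$ linearly independent, and $\mathcal M=\{\rho\in\mathcal S(\mathcal H):\operatorname{Tr}(\rho H_j)=c_j,\ j=1,\dots,k\}$ is assumed to contain a positive-definite state; $\mathcal M_{++}=\{\rho\in\mathcal M:\rho\succ0\}$. $T_{\mathcal M}=\{X\in\mathcal B(\mathcal H):\operatorname{Tr}X=0,\ \operatorname{Tr}(XH_j)=0\ \forall j\}$ and $N_{\mathcal M}=T_{\mathcal M}^\perp=\operatorname{span}\{I,H_1,\dots,H_k\}$. $\Omega:\mathcal S(\mathcal H)\to\mathcal B(\mathcal H)$ is continuous, and $\gamma>0$. $f$ is differentiable relative to the affine hull of $\mathcal M$: $\nabla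 f(\rho)\in\mathcal B(\mathcal H)$ denotes an operator with $f(\sigma)=f(\rho)+\operatorname{Tr}[\nabla f(\rho)(\sigma-\rho)]+o(\|\sigma-\rho\|)$ as $\sigma\to\rho$ in $\mathcal M$ (determined up to adding elements of $N_{\mathcal M}$). $D(\sigma\|\rho)=\operatorname{Tr}\,\sigma(\log\sigma-\log\rho)$ (with $0\log0=0$). For $\rho\in\mathcal M_{++}$ the Arimoto–Blahut (AB) map is $\mathcal T_{AB}(\rho)=\arg\min_{\sigma\in\mathcal M}D(\sigma\|\mathcal F_3[\rho])$, where $\mathcal F_3[\rho]=\exp(\log\rho-\tfrac1\gamma\Omega(\rho))/\operatorname{Tr}\exp(\log\rho-\tfrac1\gamma\Omega(\rho))$, and the mirror-descent (MD) map is $\mathcal T_{MD}(\rho)=\arg\min_{\sigma\in\mathcal M}\{\operatorname{Tr}[\sigma\nabla f(\rho)]+\gamma D(\sigma\|\rho)\}$. *)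

theory Defs
  imports "HOL-Analysis.Analysis"
begin

section \<open>Hermitian matrices\<close>

type_synonym 'n cmat = "complex^'n^'n"

definition conj_transpose :: "'n::finite cmat \<Rightarrow> 'n cmat" where
  "conj_transpose A = (\<chi> i j. cnj (A $ j $ i))"

definition hermitian :: "'n::finite cmat \<Rightarrow> bool" where
  "hermitian A \<longleftrightarrow> conj_transpose A = A"

definition unitary :: "'n::finite cmat \<Rightarrow> bool" where
  "unitary U \<longleftrightarrow> U ** conj_transpose U = mat 1 \<and> conj_transpose U ** U = mat 1"

text \<open>The inner product on \<^typ>\<open>complex^'n\<close> is the real one, that is, the real part of the
  sesquilinear product; for Hermitian \<open>A\<close> the number \<open>\<langle>x, A x\<rangle>\<close> is real, so nothing is lost.\<close>

definition pos_semidef :: "'n::finite cmat \<Rightarrow> bool" where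
  "pos_semidef A \<longleftrightarrow> hermitian A \<and> (\<forall>x. 0 \<le> x \<bullet> (A *v x))"

definition pos_def :: "'n::finite cmat \<Rightarrow> bool" where
  "pos_def A \<longleftrightarrow> hermitian A \<and> (\<forall>x. x \<noteq> 0 \<longrightarrow> 0 < x \<bullet> (A *v x))"

definition density_ops :: "'n::finite cmat set" where
  "density_ops = {\<rho>. pos_semidef \<rho> \<and> trace \<rho> = 1}"

section \<open>Functional calculus and relative entropy\<close>

definition real_diag :: "('n::finite \<Rightarrow> real) \<Rightarrow> 'n cmat" where
  "real_diag d = (\<chi> i j. if i = j then complex_of_real (d i) else 0)"

text \<open>\<open>g(A)\<close> for Hermitian \<open>A\<close>. The value does not depend on the chosen diagonalization,
  see \<open>herm_fun_diagonalized\<close> below.\<close>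

definition herm_fun :: "(real \<Rightarrow> real) \<Rightarrow> 'n::finite cmat \<Rightarrow> 'n cmat" where
  "herm_fun g A = (THE B. \<exists>U d. unitary U \<and>
      A = U ** real_diag d ** conj_transpose U \<and>
      B = U ** real_diag (g \<circ> d) ** conj_transpose U)"

definition mat_exp :: "'n::finite cmat \<Rightarrow> 'n cmat" where
  "mat_exp = herm_fun exp"

definition mat_log :: "'n::finite cmat \<Rightarrow> 'n cmat" where
  "mat_log = herm_fun ln"

text \<open>Since \<open>ln 0 = 0\<close> in HOL, \<open>\<sigma> log \<sigma>\<close> follows the convention \<open>0 log 0 = 0\<close> for singular
  states \<open>\<sigma>\<close>. The second argument is meant to be positive definite; the value \<open>+\<infinity>\<close> that
  occurs for a singular second argument is not modelled.\<close>

definition rel_entropy :: "'n::finite cmat \<Rightarrow> 'n cmat \<Rightarrow> real" where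
  "rel_entropy \<sigma> \<rho> = Re (trace (\<sigma> ** (mat_log \<sigma> - mat_log \<rho>)))"

section \<open>The linear family\<close>

definition lin_family :: "nat \<Rightarrow> (nat \<Rightarrow> 'n::finite cmat) \<Rightarrow> (nat \<Rightarrow> real) \<Rightarrow> 'n cmat set" where
  "lin_family k H c = {\<rho> \<in> density_ops. \<forall>j\<in>{1..k}. trace (\<rho> ** H j) = complex_of_real (c j)}"

definition lin_family_pos :: "nat \<Rightarrow> (nat \<Rightarrow> 'n::finite cmat) \<Rightarrow> (nat \<Rightarrow> real) \<Rightarrow> 'n cmat set" where
  "lin_family_pos k H c = {\<rho> \<in> lin_family k H c. pos_def \<rho>}"

definition tangent_subspace :: "nat \<Rightarrow> (nat \<Rightarrow> 'n::finite cmat) \<Rightarrow> 'n cmat set" where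
  "tangent_subspace k H = {X. hermitian X \<and> trace X = 0 \<and> (\<forall>j\<in>{1..k}. trace (X ** H j) = 0)}"

text \<open>Orthogonal complement of the tangent space within the Hermitian matrices, which is also
  the real span of the identity and the \<open>H j\<close> (\<open>normal_eq_span\<close> below).\<close>

definition normal_subspace :: "nat \<Rightarrow> (nat \<Rightarrow> 'n::finite cmat) \<Rightarrow> 'n cmat set" where
  "normal_subspace k H = {Y. hermitian Y \<and> (\<forall>X\<in>tangent_subspace k H. trace (X ** Y) = 0)}"

text \<open>Only increments inside \<open>M\<close> matter, so \<open>G\<close> is determined up to the normal space.
  The norm is the Frobenius norm.\<close>

definition is_gradient_on ::
    "'n::finite cmat set \<Rightarrow> ('n cmat \<Rightarrow> real) \<Rightarrow> ('n cmat \<Rightarrow> 'n cmat) \<Rightarrow> bool" where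
  "is_gradient_on M f G \<longleftrightarrow> (\<forall>\<rho>\<in>M. hermitian (G \<rho>) \<and>
      (f has_derivative (\<lambda>X. Re (trace (G \<rho> ** X)))) (at \<rho> within M))"

section \<open>The two iteration maps\<close>

definition objective :: "('n::finite cmat \<Rightarrow> 'n cmat) \<Rightarrow> 'n cmat \<Rightarrow> real" where
  "objective \<Omega> \<rho> = Re (trace (\<rho> ** \<Omega> \<rho>))"

definition gibbs_update :: "real \<Rightarrow> ('n::finite cmat \<Rightarrow> 'n cmat) \<Rightarrow> 'n cmat \<Rightarrow> 'n cmat" where
  "gibbs_update \<gamma> \<Omega> \<rho> = (let E = mat_exp (mat_log \<rho> - (1 / \<gamma>) *\<^sub>R \<Omega> \<rho>)
     in (1 / Re (trace E)) *\<^sub>R E)"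

definition T_AB :: "'n::finite cmat set \<Rightarrow> real \<Rightarrow> ('n cmat \<Rightarrow> 'n cmat) \<Rightarrow> 'n cmat \<Rightarrow> 'n cmat" where
  "T_AB M \<gamma> \<Omega> \<rho> = arg_min_on (\<lambda>\<sigma>. rel_entropy \<sigma> (gibbs_update \<gamma> \<Omega> \<rho>)) M"

text \<open>\<open>G\<close> is a gradient of the objective.\<close>

definition T_MD :: "'n::finite cmat set \<Rightarrow> real \<Rightarrow> ('n cmat \<Rightarrow> 'n cmat) \<Rightarrow> 'n cmat \<Rightarrow> 'n cmat" where
  "T_MD M \<gamma> G \<rho> = arg_min_on (\<lambda>\<sigma>. Re (trace (\<sigma> ** G \<rho>)) + \<gamma> * rel_entropy \<sigma> \<rho>) M"

section \<open>Sanity checks\<close>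

lemma herm_fun_unique:
  assumes U: "unitary U" and V: "unitary V"
    and eq: "U ** real_diag d ** conj_transpose U = V ** real_diag e ** conj_transpose V"
  shows "U ** real_diag (g \<circ> d) ** conj_transpose U = V ** real_diag (g \<circ> e) ** conj_transpose V"
proof -
  define W where "W = conj_transpose V ** U"
  have UU: "conj_transpose U ** U = mat 1" "U ** conj_transpose U = mat 1"
    and VV: "conj_transpose V ** V = mat 1" "V ** conj_transpose V = mat 1"
    using U V by (auto simp: unitary_def)
  have r: "(A ** real_diag a) $ i $ j = A $ i $ j * complex_of_real (a j)"
    for A :: "'a cmat" and a i j
    by (simp add: matrix_matrix_mult_def real_diag_def if_distrib cong: if_cong)
  have l: "(real_diag a ** A) $ i $ j = complex_of_real (a i) * A $ i $ j"
    for A :: "'a cmat" and a i j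
    by (simp add: matrix_matrix_mult_def real_diag_def if_distrib if_distribR cong: if_cong)
  have "W ** real_diag d = conj_transpose V ** (U ** real_diag d ** conj_transpose U) ** U"
    by (simp add: W_def matrix_mul_assoc[symmetric] UU)
  also have "\<dots> = (conj_transpose V ** V) ** real_diag e ** W"
    by (simp add: eq W_def matrix_mul_assoc)
  finally have com: "W ** real_diag d = real_diag e ** W"
    by (simp add: VV)
  have "W $ i $ j * complex_of_real (g (d j)) = complex_of_real (g (e i)) * W $ i $ j" for i j
  proof -
    have "W $ i $ j * complex_of_real (d j) = complex_of_real (e i) * W $ i $ j"
      unfolding r[symmetric] l[symmetric] com ..
    then have "W $ i $ j = 0 \<or> d j = e i"
      by (metis mult.commute mult_cancel_left of_real_eq_iff)
    then show ?thesis by (elim disjE) simp_all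
  qed
  then have com': "W ** real_diag (g \<circ> d) = real_diag (g \<circ> e) ** W"
    by (simp add: vec_eq_iff r l)
  have "U ** real_diag (g \<circ> d) ** conj_transpose U
      = V ** (W ** real_diag (g \<circ> d)) ** conj_transpose U"
    by (simp add: W_def matrix_mul_assoc VV)
  also have "\<dots> = V ** real_diag (g \<circ> e) ** conj_transpose V ** (U ** conj_transpose U)"
    unfolding com' by (simp add: W_def matrix_mul_assoc)
  finally show ?thesis by (simp add: UU)
qed

lemma herm_fun_diagonalized:
  assumes "unitary U"
  shows "herm_fun g (U ** real_diag d ** conj_transpose U)
    = U ** real_diag (g \<circ> d) ** conj_transpose U"
  unfolding herm_fun_def
proof (rule the_equality)
  show "\<exists>V e. unitary V \<and>
      U ** real_diag d ** conj_transpose U = V ** real_diag e ** conj_transpose V \<and>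
      U ** real_diag (g \<circ> d) ** conj_transpose U = V ** real_diag (g \<circ> e) ** conj_transpose V"
    using assms by blast
next
  fix B
  assume "\<exists>V e. unitary V \<and>
      U ** real_diag d ** conj_transpose U = V ** real_diag e ** conj_transpose V \<and>
      B = V ** real_diag (g \<circ> e) ** conj_transpose V"
  then show "B = U ** real_diag (g \<circ> d) ** conj_transpose U"
    using herm_fun_unique[OF assms] by metis
qed

lemma trace_mult_hermitian:
  fixes X Y :: "'n::finite cmat"
  assumes "hermitian X" "hermitian Y"
  shows "trace (X ** Y) = complex_of_real (X \<bullet> Y)"
proof (rule complex_eqI)
  have herm: "cnj (A $ i $ j) = A $ j $ i" if "hermitian A" for A :: "'n cmat" and i j
  proof -
    have "A $ j $ i = conj_transpose A $ j $ i"
      using that by (simp only: hermitian_def)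
    then show ?thesis by (simp add: conj_transpose_def)
  qed
  note X = herm[OF assms(1)] and Y = herm[OF assms(2)]
  have "cnj (trace (X ** Y)) = (\<Sum>i\<in>UNIV. \<Sum>j\<in>UNIV. X $ j $ i * Y $ i $ j)"
    by (simp add: trace_def matrix_matrix_mult_def X Y)
  also have "\<dots> = trace (X ** Y)"
    by (subst sum.swap) (simp add: trace_def matrix_matrix_mult_def)
  finally show "Im (trace (X ** Y)) = Im (complex_of_real (X \<bullet> Y))"
    by (simp add: complex_eq_iff)
  have "Re (trace (X ** Y)) = (\<Sum>i\<in>UNIV. \<Sum>j\<in>UNIV. Re (X $ i $ j * cnj (Y $ i $ j)))"
    unfolding trace_def matrix_matrix_mult_def Y by simp
  then show "Re (trace (X ** Y)) = Re (complex_of_real (X \<bullet> Y))"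
    by (simp add: inner_vec_def inner_complex_def)
qed

lemma normal_eq_span:
  assumes H: "\<forall>j\<in>{1..k}. hermitian (H j)"
  shows "normal_subspace k H = span (insert (mat 1) (H ` {1..k}))"
proof -
  let ?S = "insert (mat 1) (H ` {1..k})"
  let ?N = "span ?S"
  have herm_sub: "subspace {X :: 'a cmat. hermitian X}"
    by (auto simp: subspace_def hermitian_def conj_transpose_def vec_eq_iff)
  have one: "hermitian (mat 1 :: 'a cmat)"
    by (auto simp: hermitian_def conj_transpose_def mat_def vec_eq_iff)
  have S_herm: "?S \<subseteq> {X. hermitian X}"
    using H one by auto
  have N_herm: "?N \<subseteq> {X. hermitian X}"
    by (rule span_minimal[OF S_herm herm_sub])
  have T: "X \<in> tangent_subspace k H \<longleftrightarrow> hermitian X \<and> (\<forall>Y\<in>?S. X \<bullet> Y = 0)" for X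
  proof (cases "hermitian X")
    case True
    have "trace X = complex_of_real (X \<bullet> mat 1)"
      using trace_mult_hermitian[OF True one] by simp
    then show ?thesis
      using True H by (auto simp: tangent_subspace_def trace_mult_hermitian)
  qed (simp add: tangent_subspace_def)
  show ?thesis
  proof
    show "?N \<subseteq> normal_subspace k H"
    proof
      fix Y assume Y: "Y \<in> ?N"
      have "trace (X ** Y) = 0" if X: "X \<in> tangent_subspace k H" for X
      proof -
        have "?N \<subseteq> {Y. X \<bullet> Y = 0}"
          by (rule span_minimal) (use X T in \<open>auto simp: subspace_def inner_right_distrib\<close>)
        then have "X \<bullet> Y = 0" using Y by blast
        moreover have "hermitian X" "hermitian Y" using X T Y N_herm by blast+
        ultimately show ?thesis by (simp add: trace_mult_hermitian)
      qed
      then show "Y \<in> normal_subspace k H" using Y N_herm by (auto simp: normal_subspace_def)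
    qed
    show "normal_subspace k H \<subseteq> ?N"
    proof
      fix Y assume Y: "Y \<in> normal_subspace k H"
      obtain Z W where ZW: "Z \<in> ?N" "\<And>w. w \<in> ?N \<Longrightarrow> orthogonal W w" "Y = Z + W"
        using orthogonal_subspace_decomp_exists[of ?S Y] by (metis span_span)
      have "hermitian Y" using Y by (simp add: normal_subspace_def)
      then have W: "hermitian W"
        using subspace_diff[OF herm_sub, of Y Z] ZW N_herm by auto
      have "W \<in> tangent_subspace k H"
        using W ZW(2) span_base[of _ ?S] T by (auto simp: orthogonal_def)
      then have "W \<bullet> Y = 0"
        using Y W trace_mult_hermitian[of W Y] by (auto simp: normal_subspace_def)
      moreover have "W \<bullet> Z = 0" using ZW by (auto simp: orthogonal_def)
      ultimately have "W = 0" using ZW(3) by (simp add: inner_right_distrib)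
      then show "Y \<in> ?N" using ZW by simp
    qed
  qed
qed

end

theory Submission
  imports Defs
begin

text \<open>Both maps minimize over \<open>M\<close> a functional \<open>F(\<sigma>) = Tr \<sigma> log \<sigma> + Tr \<sigma> K\<close>. If a positive
  definite \<open>\<rho>\<close> minimizes \<open>F\<close>, then \<open>log \<rho> + K\<close> is orthogonal to the tangent space: one has
  \<open>F(\<rho> + tX) - F(\<rho>) = t Tr X (log \<rho> + K) + D(\<rho> + tX \<parallel> \<rho>)\<close>, and the relative entropy is bounded
  by the chi-square divergence \<open>t\<^sup>2 Tr X\<^sup>2 \<rho>\<^sup>-\<^sup>1\<close>, so the matrix logarithm never has to be
  differentiated. At an AB fixed point this says \<open>\<Omega>(\<rho>) \<in> N\<close>. For the MD map it says that \<open>\<rho>\<close> is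
  fixed only if \<open>\<nabla>f(\<rho>) \<in> N\<close>; conversely, in that case the MD objective is a constant plus
  \<open>\<gamma> D(\<sigma> \<parallel> \<rho>)\<close>, which by the strict Klein inequality has \<open>\<rho>\<close> as its only minimizer. Finally,
  \<open>\<nabla>f(\<rho>) \<in> N\<close> is the optimality condition of the convex function \<open>f\<close>. The iteration maps are
  defined by choice, so a fixed point is known to be a minimizer only once minimizers exist.\<close>

abbreviation rtrace :: "'n::finite cmat \<Rightarrow> real" where
  "rtrace A \<equiv> Re (trace A)"

section \<open>Matrix algebra\<close>

text \<open>Real bilinearity suffices in finite dimension. The interpretation \<open>mm\<close>
  below supplies the additive and real-scalar rules that expand matrix products.\<close>

lemma bounded_bilinear_matrix_mult:
  "bounded_bilinear ((**) :: 'n::finite cmat \<Rightarrow> 'n cmat \<Rightarrow> 'n cmat)"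
proof -
  have "bilinear ((**) :: 'n cmat \<Rightarrow> 'n cmat \<Rightarrow> 'n cmat)"
    unfolding bilinear_def
    by (intro conjI allI linearI)
      (simp_all add: vec_eq_iff matrix_matrix_mult_def algebra_simps sum.distrib
        scaleR_sum_right)
  then show ?thesis
    by (simp add: bilinear_conv_bounded_bilinear)
qed

interpretation mm: bounded_bilinear "(**) :: 'n::finite cmat \<Rightarrow> 'n cmat \<Rightarrow> 'n cmat"
  by (rule bounded_bilinear_matrix_mult)

lemma bounded_linear_rtrace: "bounded_linear (rtrace :: 'n::finite cmat \<Rightarrow> real)"
  unfolding linear_conv_bounded_linear[symmetric]
  by (rule linearI) (simp_all add: trace_def sum.distrib sum_distrib_left)

lemma rtrace_simps:
  fixes A B :: "'n::finite cmat"
  shows "rtrace (A + B) = rtrace A + rtrace B" "rtrace (A - B) = rtrace A - rtrace B"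
    "rtrace (- A) = - rtrace A" "rtrace (r *\<^sub>R A) = r * rtrace A"
  by (simp_all add: trace_def sum.distrib sum_subtractf sum_negf sum_distrib_left)

lemma bounded_linear_matrix_vector_left:
  "bounded_linear (\<lambda>A. A *v x :: complex^'n)" for x :: "complex^'n::finite"
  unfolding linear_conv_bounded_linear[symmetric]
  by (rule linearI)
    (simp_all add: vec_eq_iff matrix_vector_mult_def algebra_simps sum.distrib scaleR_sum_right)

lemma scaleR_cmat_vector: "(r *\<^sub>R A) *v x = r *\<^sub>R (A *v x)" for A :: "'n::finite cmat"
  using linear_scale[OF bounded_linear.linear[OF bounded_linear_matrix_vector_left]] .

lemma conj_transpose_mult:
  "conj_transpose (A ** B) = conj_transpose B ** conj_transpose A" for A :: "'n::finite cmat"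
  by (simp add: conj_transpose_def matrix_matrix_mult_def vec_eq_iff mult.commute)

lemma conj_transpose_conj_transpose [simp]: "conj_transpose (conj_transpose A) = A"
  by (simp add: conj_transpose_def vec_eq_iff)

lemma subspace_hermitian: "subspace {X :: 'n::finite cmat. hermitian X}"
  by (auto simp: subspace_def hermitian_def conj_transpose_def vec_eq_iff)

lemma hermitian_add: "hermitian A \<Longrightarrow> hermitian B \<Longrightarrow> hermitian (A + B)"
  using subspace_add[OF subspace_hermitian] by blast

lemma hermitian_diff: "hermitian A \<Longrightarrow> hermitian B \<Longrightarrow> hermitian (A - B)"
  using subspace_diff[OF subspace_hermitian] by blast

lemma hermitian_scaleR: "hermitian A \<Longrightarrow> hermitian (r *\<^sub>R A)"
  using subspace_scale[OF subspace_hermitian] by blast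

lemma inner_conj_transpose:
  "x \<bullet> (A *v y) = (conj_transpose A *v x) \<bullet> y" for A :: "'n::finite cmat"
proof -
  have "x \<bullet> (A *v y) = (\<Sum>i\<in>UNIV. \<Sum>j\<in>UNIV. Re (cnj (x $ i) * A $ i $ j * y $ j))"
    by (simp add: inner_vec_def matrix_vector_mult_def inner_complex_def
        sum_distrib_left sum_distrib_right algebra_simps sum.distrib sum_subtractf)
  also have "\<dots> = (\<Sum>j\<in>UNIV. \<Sum>i\<in>UNIV. Re (cnj (x $ i) * A $ i $ j * y $ j))"
    by (rule sum.swap)
  also have "\<dots> = (conj_transpose A *v x) \<bullet> y"
    by (simp add: inner_vec_def matrix_vector_mult_def inner_complex_def conj_transpose_def
        sum_distrib_left sum_distrib_right algebra_simps sum.distrib sum_subtractf)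
  finally show ?thesis .
qed

lemma mult_real_diag_nth: "(A ** real_diag a) $ i $ j = A $ i $ j * complex_of_real (a j)"
  by (simp add: matrix_matrix_mult_def real_diag_def if_distrib cong: if_cong)

lemma real_diag_mult_nth: "(real_diag a ** A) $ i $ j = complex_of_real (a i) * A $ i $ j"
  by (simp add: matrix_matrix_mult_def real_diag_def if_distrib if_distribR cong: if_cong)

lemma real_diag_mult: "real_diag a ** real_diag b = real_diag (\<lambda>i. a i * b i)"
  by (simp only: vec_eq_iff real_diag_mult_nth) (simp add: real_diag_def)

lemma real_diag_vec: "real_diag a *v x = (\<chi> i. complex_of_real (a i) * x $ i)"
  by (simp add: real_diag_def matrix_vector_mult_def vec_eq_iff if_distrib[where f = "\<lambda>z. z * _"]
      cong: if_cong)

lemma conj_transpose_real_diag [simp]: "conj_transpose (real_diag a) = real_diag a"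
  by (auto simp: real_diag_def conj_transpose_def vec_eq_iff)

lemma real_diag_const_1: "real_diag (\<lambda>_. 1) = mat 1"
  by (simp add: real_diag_def mat_def vec_eq_iff)

section \<open>The spectral theorem\<close>

text \<open>The polynomial has a local minimum at \<open>t = 0\<close>, where its derivative is
  \<open>a\<close>. It serves two variational arguments: for eigenvectors and for the free
  energy.\<close>

lemma linear_term_zero:
  fixes a C \<epsilon> :: real
  assumes "0 < \<epsilon>" and "\<And>t. \<bar>t\<bar> \<le> \<epsilon> \<Longrightarrow> 0 \<le> t * a + C * t\<^sup>2"
  shows "a = 0"
proof (rule DERIV_local_min)
  show "((\<lambda>t. t * a + C * t\<^sup>2) has_real_derivative a) (at 0)"
    by (auto intro!: derivative_eq_intros)
  show "\<forall>t. \<bar>0 - t\<bar> < \<epsilon> \<longrightarrow> 0 * a + C * 0\<^sup>2 \<le> t * a + C * t\<^sup>2"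
    using assms(2) by simp
qed (rule assms(1))

text \<open>Compactness yields a maximizer \<open>x\<close> of the quadratic form on the unit sphere
  of \<open>W\<close>; the maximum is its eigenvalue.\<close>

lemma selfadjoint_eigenvector_exists:
  fixes f :: "'a::euclidean_space \<Rightarrow> 'a"
  assumes f: "linear f" and self: "\<And>x y. x \<bullet> f y = f x \<bullet> y"
    and W: "subspace W" "W \<noteq> {0}" and inv: "\<And>x. x \<in> W \<Longrightarrow> f x \<in> W"
  obtains x l where "x \<in> W" "norm x = 1" "f x = l *\<^sub>R x"
proof -
  have blf: "bounded_linear f" using f by (simp add: linear_conv_bounded_linear)
  obtain w where w: "w \<in> W" "w \<noteq> 0" using W subspace_0 by blast
  have "compact (sphere 0 1 \<inter> W)"
    by (intro compact_Int_closed compact_sphere closed_subspace W)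
  moreover have "(1 / norm w) *\<^sub>R w \<in> sphere 0 1 \<inter> W"
    using w W by (simp add: subspace_scale)
  moreover have "continuous_on (sphere 0 1 \<inter> W) (\<lambda>x. x \<bullet> f x)"
    by (intro continuous_intros bounded_linear.continuous_on[OF blf])
  ultimately obtain x where x: "x \<in> sphere 0 1 \<inter> W"
      and max: "\<And>y. y \<in> sphere 0 1 \<inter> W \<Longrightarrow> y \<bullet> f y \<le> x \<bullet> f x"
    using continuous_attains_sup[of "sphere 0 1 \<inter> W" "\<lambda>x. x \<bullet> f x"] by blast
  define l where "l = x \<bullet> f x"
  have xx: "x \<bullet> x = 1" using x by (simp add: norm_eq_1)
  \<comment> \<open>By homogeneity, maximality on the sphere becomes nonnegativity of a form on all
    of \<open>W\<close>, with value zero at \<open>x\<close>.\<close>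
  have q: "0 \<le> l * (y \<bullet> y) - y \<bullet> f y" if "y \<in> W" for y
  proof (cases "y = 0")
    case False
    have "(1 / norm y) *\<^sub>R y \<in> sphere 0 1 \<inter> W"
      using that False W by (simp add: subspace_scale)
    from max[OF this] have "(y \<bullet> f y) / (norm y)\<^sup>2 \<le> l"
      by (simp add: l_def linear_scale[OF f] power2_eq_square)
    then show ?thesis using False by (simp add: divide_le_eq power2_norm_eq_inner)
  qed (simp add: linear_0[OF f])
  \<comment> \<open>Perturbing \<open>x\<close> along its own residual gives the form the linear
    coefficient \<open>2 * (y \<bullet> y)\<close>, which must vanish.\<close>
  define y where "y = l *\<^sub>R x - f x"
  have y: "y \<in> W" unfolding y_def using x inv W by (auto intro: subspace_diff subspace_scale)
  have "0 \<le> t * (2 * (y \<bullet> y)) + (l * (y \<bullet> y) - y \<bullet> f y) * t\<^sup>2" for t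
  proof -
    have "x + t *\<^sub>R y \<in> W" using x y W by (auto intro: subspace_add subspace_scale)
    from q[OF this] have "0 \<le> l * ((x + t *\<^sub>R y) \<bullet> (x + t *\<^sub>R y)) - (x + t *\<^sub>R y) \<bullet> f (x + t *\<^sub>R y)" .
    also have "\<dots> = (l - x \<bullet> f x) + t * (2 * (l * (x \<bullet> y) - f x \<bullet> y)) + (l * (y \<bullet> y) - y \<bullet> f y) * t\<^sup>2"
      by (simp add: linear_add[OF f] linear_scale[OF f] inner_simps self[of x y] xx
          inner_commute[of y x] inner_commute[of y "f x"] power2_eq_square algebra_simps)
    also have "l * (x \<bullet> y) - f x \<bullet> y = y \<bullet> y"
      by (simp add: y_def inner_simps inner_commute[of "f x" x])
    finally show ?thesis by (simp add: l_def)
  qed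
  then have "2 * (y \<bullet> y) = 0" using linear_term_zero[OF zero_less_one] by blast
  then have "f x = l *\<^sub>R x" by (simp add: y_def)
  then show ?thesis using that x by auto
qed

section \<open>Orthonormal eigenbases over the complex numbers\<close>

definition cinner :: "complex^'n::finite \<Rightarrow> complex^'n \<Rightarrow> complex" where
  "cinner x y = (\<Sum>i\<in>UNIV. cnj (x $ i) * y $ i)"

lemma cinner_eq_inner: "cinner x y = Complex (x \<bullet> y) ((\<i> *s x) \<bullet> y)"
  by (rule complex_eqI) (simp_all add: cinner_def inner_vec_def inner_complex_def)

lemma cinner_commute: "cinner y x = cnj (cinner x y)"
  by (simp add: cinner_def mult.commute)

lemma cinner_self: "cinner x x = complex_of_real ((norm x)\<^sup>2)"
  unfolding power2_norm_eq_inner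
  by (rule complex_eqI) (simp_all add: cinner_def inner_vec_def inner_complex_def mult.commute)

text \<open>By induction, the next eigenvector is sought in the complex orthogonal complement of
  those already found, which \<open>A\<close> preserves because it is self-adjoint.\<close>

lemma hermitian_orthonormal_eigenvectors:
  fixes A :: "'n::finite cmat"
  assumes A: "hermitian A" and "m \<le> CARD('n)"
  shows "\<exists>B. finite B \<and> card B = m \<and> (\<forall>x\<in>B. \<forall>y\<in>B. cinner x y = (if x = y then 1 else 0)) \<and>
    (\<forall>x\<in>B. \<exists>l::real. A *v x = l *\<^sub>R x)"
  using assms(2)
proof (induction m)
  case 0
  then show ?case by (intro exI[of _ "{}"]) auto
next
  case (Suc m)
  then obtain B where B: "finite B" "card B = m"
    "\<And>x y. x \<in> B \<Longrightarrow> y \<in> B \<Longrightarrow> cinner x y = (if x = y then 1 else 0)"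
    "\<And>x. x \<in> B \<Longrightarrow> \<exists>l::real. A *v x = l *\<^sub>R x" by auto
  have self: "x \<bullet> (A *v y) = (A *v x) \<bullet> y" for x y
    using inner_conj_transpose[of x A y] A by (simp add: hermitian_def)
  \<comment> \<open>Adding the multiples by \<open>\<i>\<close> makes real orthogonality to
    \<open>S\<close> the same as complex orthogonality to \<open>B\<close>.\<close>
  define S where "S = B \<union> (\<lambda>x. \<i> *s x) ` B"
  define W where "W = {y. \<forall>x\<in>S. x \<bullet> y = 0}"
  have W_iff: "y \<in> W \<longleftrightarrow> (\<forall>x\<in>B. cinner x y = 0)" for y
    by (auto simp: W_def S_def cinner_eq_inner complex_eq_iff)
  have subW: "subspace W" by (auto simp: W_def subspace_def inner_simps)
  have "dim S \<le> card S" by (rule dim_le_card') (simp add: S_def B)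
  also have "\<dots> \<le> card B + card B"
    unfolding S_def using card_Un_le card_image_le[OF B(1)] by (meson add_left_mono le_trans)
  \<comment> \<open>The real dimension is \<open>2 * CARD('n)\<close>, whereas \<open>S\<close> has
    at most \<open>2 * m\<close> elements and \<open>m < CARD('n)\<close>; so the complement is
    nontrivial.\<close>
  also have "\<dots> < DIM(complex^'n)" using B Suc.prems by simp
  finally have "dim S < DIM(complex^'n)" .
  then obtain w where w: "w \<noteq> 0" "\<And>x. x \<in> span S \<Longrightarrow> orthogonal w x"
    using orthogonal_to_subspace_exists by blast
  have "w \<in> W" using w(2) span_base[of _ S] by (auto simp: W_def orthogonal_def inner_commute)
  then have "W \<noteq> {0}" using w by auto
  have inv: "A *v y \<in> W" if y: "y \<in> W" for y
    unfolding W_def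
  proof (intro CollectI ballI)
    fix x assume x: "x \<in> S"
    have "\<exists>l::real. A *v x = l *\<^sub>R x"
    proof (cases "x \<in> B")
      case False
      then obtain z where z: "z \<in> B" "x = \<i> *s z" using x S_def by auto
      then obtain l :: real where "A *v z = l *\<^sub>R z" using B by blast
      then show ?thesis unfolding z(2) vector_scalar_commute
        by (intro exI[of _ l]) (simp add: vec_eq_iff scaleR_conv_of_real)
    qed (use B in blast)
    then obtain l :: real where "A *v x = l *\<^sub>R x" ..
    then show "x \<bullet> (A *v y) = 0" using self[of x y] y x by (simp add: W_def)
  qed
  obtain x l where x: "x \<in> W" "norm x = 1" "A *v x = l *\<^sub>R x"
    using selfadjoint_eigenvector_exists[OF matrix_vector_mul_linear self subW \<open>W \<noteq> {0}\<close> inv] by metis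
  have x1: "cinner x x = 1" using x by (simp add: cinner_self)
  have xB: "x \<notin> B" using x x1 W_iff by auto
  show ?case
  proof (intro exI[of _ "insert x B"] conjI)
    show "card (insert x B) = Suc m" using B xB by simp
    show "\<forall>y\<in>insert x B. \<exists>l::real. A *v y = l *\<^sub>R y" using x B by blast
    have "cinner y x = 0" "cinner x y = 0" if "y \<in> B" for y
      using x W_iff that cinner_commute[of x y] by auto
    then show "\<forall>y\<in>insert x B. \<forall>z\<in>insert x B. cinner y z = (if y = z then 1 else 0)"
      using x1 xB B(3) by auto
  qed (use B in simp)
qed

text \<open>The columns of \<open>U\<close> are a full orthonormal set of eigenvectors:
  \<open>conj_transpose U ** U\<close> is their Gram matrix, and \<open>A ** U\<close> scales each
  column.\<close>

lemma hermitian_diagonalization: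
  fixes A :: "'n::finite cmat"
  assumes "hermitian A"
  obtains U d where "unitary U" "A = U ** real_diag d ** conj_transpose U"
proof -
  obtain B where B: "finite B" "card B = CARD('n)"
    "\<And>x y. x \<in> B \<Longrightarrow> y \<in> B \<Longrightarrow> cinner x y = (if x = y then 1 else 0)"
    "\<And>x. x \<in> B \<Longrightarrow> \<exists>l::real. A *v x = l *\<^sub>R x"
    using hermitian_orthonormal_eigenvectors[OF assms order_refl] by blast
  obtain e :: "'n \<Rightarrow> complex^'n" where e: "bij_betw e UNIV B"
    using finite_same_card_bij[of "UNIV::'n set" B] B by auto
  then have eB: "e i \<in> B" for i by (auto simp: bij_betw_def)
  then have "\<forall>i. \<exists>l::real. A *v e i = l *\<^sub>R e i" using B(4) by blast
  then obtain d :: "'n \<Rightarrow> real" where d: "\<And>i. A *v e i = d i *\<^sub>R e i"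
    unfolding choice_iff by blast
  define U :: "'n cmat" where "U = (\<chi> i j. e j $ i)"
  have "conj_transpose U ** U = (\<chi> i j. cinner (e i) (e j))"
    by (simp add: U_def conj_transpose_def matrix_matrix_mult_def cinner_def)
  also have "\<dots> = mat 1"
  proof -
    have "e i = e j \<longleftrightarrow> i = j" for i j using e by (simp add: bij_betw_def inj_eq)
    then show ?thesis by (simp add: B(3)[OF eB eB] mat_def)
  qed
  finally have UU: "conj_transpose U ** U = mat 1" .
  then have UU': "U ** conj_transpose U = mat 1"
    using matrix_left_right_inverse by blast
  have "(A ** U) $ i $ j = (U ** real_diag d) $ i $ j" for i j
  proof -
    have "(A ** U) $ i $ j = (A *v e j) $ i"
      by (simp add: U_def matrix_matrix_mult_def matrix_vector_mult_def)
    also have "\<dots> = (U ** real_diag d) $ i $ j"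
      unfolding d mult_real_diag_nth vector_scaleR_component
      by (simp add: U_def scaleR_conv_of_real[where 'a = complex] mult.commute)
    finally show ?thesis .
  qed
  then have "A ** U = U ** real_diag d" by (simp add: vec_eq_iff)
  then have "A = U ** real_diag d ** conj_transpose U"
    by (metis UU' matrix_mul_assoc matrix_mul_rid)
  then show ?thesis using that UU UU' by (auto simp: unitary_def)
qed

section \<open>Klein's inequality\<close>

abbreviation spectral :: "'n::finite cmat \<Rightarrow> ('n \<Rightarrow> real) \<Rightarrow> 'n cmat" where
  "spectral U a \<equiv> U ** real_diag a ** conj_transpose U"

lemma hermitian_spectral: "hermitian (spectral U a)"
  by (simp add: hermitian_def conj_transpose_mult matrix_mul_assoc)

lemma spectral_mult:
  assumes "unitary U"
  shows "spectral U a ** spectral U b = spectral U (\<lambda>i. a i * b i)"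
proof -
  have "spectral U a ** spectral U b
      = U ** real_diag a ** (conj_transpose U ** U) ** real_diag b ** conj_transpose U"
    by (simp add: matrix_mul_assoc)
  also have "\<dots> = U ** (real_diag a ** real_diag b) ** conj_transpose U"
    using assms by (simp add: unitary_def matrix_mul_assoc)
  finally show ?thesis by (simp add: real_diag_mult)
qed

lemma spectral_1: "unitary U \<Longrightarrow> spectral U (\<lambda>_. 1) = mat 1"
  by (simp add: real_diag_const_1 unitary_def)

lemma spectral_scaleR: "spectral U (\<lambda>i. r * a i) = r *\<^sub>R spectral U a"
proof -
  have "real_diag (\<lambda>i. r * a i) = r *\<^sub>R real_diag a"
    by (simp add: real_diag_def vec_eq_iff scaleR_conv_of_real[where 'a = complex])
  then show ?thesis by (simp add: mm.scaleR_left mm.scaleR_right)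
qed

lemma spectral_diff: "spectral U (\<lambda>i. a i - b i) = spectral U a - spectral U b"
proof -
  have "real_diag (\<lambda>i. a i - b i) = real_diag a - real_diag b"
    by (simp add: real_diag_def vec_eq_iff)
  then show ?thesis by (simp add: mm.diff_left mm.diff_right)
qed

lemma mat_log_spectral: "unitary U \<Longrightarrow> mat_log (spectral U a) = spectral U (\<lambda>i. ln (a i))"
  by (simp add: mat_log_def herm_fun_diagonalized o_def)

lemma mat_exp_spectral: "unitary U \<Longrightarrow> mat_exp (spectral U a) = spectral U (\<lambda>i. exp (a i))"
  by (simp add: mat_exp_def herm_fun_diagonalized o_def)

lemma rtrace_spectral: "unitary U \<Longrightarrow> rtrace (spectral U a) = (\<Sum>i\<in>UNIV. a i)"
proof -
  assume "unitary U"
  have "trace (spectral U a) = trace (conj_transpose U ** (U ** real_diag a))"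
    by (rule trace_mul_sym)
  also have "\<dots> = trace (real_diag a)"
    using \<open>unitary U\<close> by (simp add: matrix_mul_assoc unitary_def)
  finally show ?thesis by (simp add: trace_def real_diag_def)
qed

text \<open>Column \<open>i\<close> of \<open>U\<close> is the witness; it is nonzero because
  \<open>conj_transpose U\<close> sends it back to the axis vector.\<close>

lemma spectral_eigenvector:
  assumes "unitary U"
  obtains x where "x \<noteq> 0" "spectral U a *v x = a i *\<^sub>R x"
proof
  let ?e = "axis i 1 :: complex^'a"
  have "conj_transpose U *v (U *v ?e) = ?e"
    using assms by (simp add: matrix_vector_mul_assoc unitary_def)
  moreover have "?e \<noteq> 0" by (simp add: axis_eq_0_iff)
  ultimately show "U *v ?e \<noteq> 0" by (metis matrix_vector_mult_0_right)
  have "spectral U a *v (U *v ?e) = (U ** real_diag a ** (conj_transpose U ** U)) *v ?e"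
    by (simp add: matrix_vector_mul_assoc matrix_mul_assoc)
  also have "\<dots> = U *v (real_diag a *v ?e)"
    using assms by (simp add: unitary_def matrix_vector_mul_assoc)
  also have "real_diag a *v ?e = a i *\<^sub>R ?e"
    unfolding real_diag_vec
    by (simp add: vec_eq_iff axis_def scaleR_conv_of_real[where 'a = complex])
  finally show "spectral U a *v (U *v ?e) = a i *\<^sub>R (U *v ?e)"
    by (simp add: linear_scale)
qed

lemma pos_semidef_diagonalization:
  assumes "pos_semidef A"
  obtains U s where "unitary U" "A = spectral U s" "\<And>i. 0 \<le> s i"
proof -
  obtain U s where U: "unitary U" "A = spectral U s"
    using assms hermitian_diagonalization by (auto simp: pos_semidef_def)
  moreover have "0 \<le> s i" for i
  proof -
    obtain x where x: "x \<noteq> 0" "A *v x = s i *\<^sub>R x"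
      using spectral_eigenvector[OF U(1), of s i] U(2) by metis
    then have "0 \<le> s i * (x \<bullet> x)"
      using assms unfolding pos_semidef_def by (metis inner_scaleR_right)
    moreover have "0 < x \<bullet> x" using x(1) by simp
    ultimately show ?thesis by (simp add: zero_le_mult_iff del: inner_gt_zero_iff)
  qed
  ultimately show ?thesis using that by blast
qed

lemma pos_def_diagonalization:
  assumes "pos_def A"
  obtains U r where "unitary U" "A = spectral U r" "\<And>i. 0 < r i"
proof -
  obtain U r where U: "unitary U" "A = spectral U r"
    using assms hermitian_diagonalization by (auto simp: pos_def_def)
  moreover have "0 < r i" for i
  proof -
    obtain x where x: "x \<noteq> 0" "A *v x = r i *\<^sub>R x"
      using spectral_eigenvector[OF U(1), of r i] U(2) by metis
    then have "0 < r i * (x \<bullet> x)"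
      using assms unfolding pos_def_def by (metis inner_scaleR_right)
    moreover have "0 < x \<bullet> x" using x(1) by simp
    ultimately show ?thesis by (rule zero_less_mult_pos2)
  qed
  ultimately show ?thesis using that by blast
qed

lemma pos_semidef_spectral:
  assumes "\<And>i. 0 \<le> s i"
  shows "pos_semidef (spectral U s)"
  unfolding pos_semidef_def
proof (intro conjI allI hermitian_spectral)
  fix x
  have "x \<bullet> (spectral U s *v x) = (conj_transpose U *v x) \<bullet> (real_diag s *v (conj_transpose U *v x))"
    by (simp add: matrix_vector_mul_assoc[symmetric] inner_conj_transpose)
  also have "\<dots> \<ge> 0"
  proof -
    have "z \<bullet> (complex_of_real a * z) = a * (cmod z)\<^sup>2" for z a
      unfolding cmod_power2 by (simp add: inner_complex_def power2_eq_square algebra_simps)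
    then show ?thesis
      unfolding real_diag_vec inner_vec_def by (simp add: sum_nonneg assms)
  qed
  finally show "0 \<le> x \<bullet> (spectral U s *v x)" .
qed

section \<open>Trace formulas for two different eigenbases\<close>

text \<open>For unitary \<open>U\<close> and \<open>V\<close> these are the transition probabilities
  between two eigenbases, a doubly stochastic matrix. As weights they reduce traces of noncommuting
  factors to scalar sums.\<close>

definition overlap :: "'n::finite cmat \<Rightarrow> 'n cmat \<Rightarrow> 'n \<Rightarrow> 'n \<Rightarrow> real" where
  "overlap U V i j = (cmod ((conj_transpose U ** V) $ i $ j))\<^sup>2"

lemma overlap_nonneg: "0 \<le> overlap U V i j"
  by (simp add: overlap_def)

text \<open>Cyclicity gives the trace of
  \<open>real_diag a ** W ** real_diag b ** conj_transpose W\<close>, whose diagonal entries contain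
  the squared moduli of \<open>W\<close>.\<close>

lemma rtrace_spectral_mult:
  "rtrace (spectral U a ** spectral V b) = (\<Sum>i\<in>UNIV. \<Sum>j\<in>UNIV. a i * b j * overlap U V i j)"
proof -
  define W where "W = conj_transpose U ** V"
  have W: "conj_transpose W = conj_transpose V ** U"
    by (simp add: W_def conj_transpose_mult)
  have "trace (spectral U a ** spectral V b)
      = trace (U ** (real_diag a ** conj_transpose U ** spectral V b))"
    by (simp add: matrix_mul_assoc)
  also have "\<dots> = trace ((real_diag a ** conj_transpose U ** spectral V b) ** U)"
    by (rule trace_mul_sym)
  also have "\<dots> = trace ((real_diag a ** W) ** (real_diag b ** conj_transpose W))"
    by (simp add: matrix_mul_assoc W) (simp add: matrix_mul_assoc W_def)
  also have "\<dots> = (\<Sum>i\<in>UNIV. \<Sum>j\<in>UNIV. (a i * b j) *\<^sub>R (W $ i $ j * cnj (W $ i $ j)))"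
    by (simp add: trace_def matrix_matrix_mult_def[of "real_diag a ** W"] real_diag_mult_nth)
      (simp add: conj_transpose_def scaleR_conv_of_real mult_ac)
  finally show ?thesis
    by (simp add: overlap_def W_def[symmetric] complex_mult_cnj cmod_power2)
qed

text \<open>With the identity as second factor, a single trace takes the same double-sum form and
  can be compared term by term with a relative entropy.\<close>

lemma rtrace_spectral_left:
  assumes "unitary V"
  shows "rtrace (spectral U a) = (\<Sum>i\<in>UNIV. \<Sum>j\<in>UNIV. a i * overlap U V i j)"
  using rtrace_spectral_mult[of U a V "\<lambda>_. 1"] assms by (simp add: spectral_1)

lemma rtrace_spectral_right:
  assumes "unitary U"
  shows "rtrace (spectral V b) = (\<Sum>i\<in>UNIV. \<Sum>j\<in>UNIV. b j * overlap U V i j)"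
  using rtrace_spectral_mult[of U "\<lambda>_. 1" V b] assms by (simp add: spectral_1)

lemma rel_entropy_spectral:
  assumes "unitary U" "unitary V"
  shows "rel_entropy (spectral U s) (spectral V r)
    = (\<Sum>i\<in>UNIV. \<Sum>j\<in>UNIV. s i * (ln (s i) - ln (r j)) * overlap U V i j)"
proof -
  have "rel_entropy (spectral U s) (spectral V r)
      = rtrace (spectral U (\<lambda>i. s i * ln (s i)))
        - rtrace (spectral U s ** spectral V (\<lambda>j. ln (r j)))"
    by (simp only: rel_entropy_def mm.diff_right rtrace_simps mat_log_spectral spectral_mult assms)
  also have "\<dots> = (\<Sum>i\<in>UNIV. \<Sum>j\<in>UNIV.
      s i * ln (s i) * overlap U V i j - s i * ln (r j) * overlap U V i j)"
    by (simp only: rtrace_spectral_mult rtrace_spectral_left[OF assms(2), of U] sum_subtractf)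
  finally show ?thesis by (simp only: right_diff_distrib left_diff_distrib)
qed

text \<open>All three rest on \<open>ln x \<le> x - 1\<close> and its equality case, with
  \<open>x = r / s\<close> for the first two and \<open>x = s / r\<close> for the third. At
  \<open>s = 0\<close> the logarithmic term vanishes through its factor \<open>s\<close>.\<close>

lemma diff_le_entropy:
  fixes s r :: real
  assumes "0 \<le> s" "0 < r"
  shows "s - r \<le> s * (ln s - ln r)" and "s * (ln s - ln r) = s - r \<Longrightarrow> s = r"
    and "s * (ln s - ln r) \<le> s * s * (1 / r) - s"
proof -
  have eq: "s * (ln s - ln r) = - s * ln (r / s)" if "s \<noteq> 0"
    using assms that by (simp add: ln_div algebra_simps)
  have le: "s * ln (r / s) \<le> r - s" if "s \<noteq> 0"
    using mult_left_mono[OF ln_le_minus_one[of "r / s"], of s] assms that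
    by (simp add: right_diff_distrib)
  show "s - r \<le> s * (ln s - ln r)"
    using eq le assms by (cases "s = 0") auto
  show "s = r" if e: "s * (ln s - ln r) = s - r"
  proof (cases "s = 0")
    case False
    then have "s * ln (r / s) = s * (r / s - 1)"
      using e eq by (simp add: right_diff_distrib)
    then have "ln (r / s) = r / s - 1" using False by simp
    moreover have "0 < r / s" using assms False by simp
    ultimately have "r / s = 1" using ln_eq_minus_one by blast
    then show ?thesis using False by simp
  qed (use e assms in simp)
  show "s * (ln s - ln r) \<le> s * s * (1 / r) - s"
  proof (cases "s = 0")
    case False
    have "s * ln (s / r) \<le> s * (s / r - 1)"
      using assms False by (intro mult_left_mono ln_le_minus_one) auto
    then show ?thesis using assms False by (simp add: ln_div right_diff_distrib)
  qed simp
qed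

text \<open>The difference of the two sides is the sum of the scalar gaps weighted by overlaps, the
  nonnegative \<open>t i j\<close>. Equality forces each of them to vanish.\<close>

lemma klein_spectral:
  assumes UV: "unitary U" "unitary V" and sr: "\<And>i. 0 \<le> s i" "\<And>i. 0 < r i"
  shows "rtrace (spectral U s) - rtrace (spectral V r) \<le> rel_entropy (spectral U s) (spectral V r)"
    and "rel_entropy (spectral U s) (spectral V r) = rtrace (spectral U s) - rtrace (spectral V r)
      \<Longrightarrow> spectral U s = spectral V r"
proof -
  define t where "t i j = (s i * (ln (s i) - ln (r j)) - (s i - r j)) * overlap U V i j" for i j
  have t: "0 \<le> t i j" for i j
    unfolding t_def using diff_le_entropy(1)[OF sr] overlap_nonneg by (intro mult_nonneg_nonneg) auto
  have eq: "rel_entropy (spectral U s) (spectral V r)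
      - (rtrace (spectral U s) - rtrace (spectral V r)) = (\<Sum>i\<in>UNIV. \<Sum>j\<in>UNIV. t i j)"
    unfolding t_def rel_entropy_spectral[OF UV] rtrace_spectral_left[OF UV(2), of U]
      rtrace_spectral_right[OF UV(1), of V]
    by (simp add: sum_subtractf[symmetric] left_diff_distrib)
  show "rtrace (spectral U s) - rtrace (spectral V r) \<le> rel_entropy (spectral U s) (spectral V r)"
  proof -
    have "0 \<le> (\<Sum>i\<in>UNIV. \<Sum>j\<in>UNIV. t i j)" by (intro sum_nonneg t)
    then show ?thesis using eq by linarith
  qed
  assume "rel_entropy (spectral U s) (spectral V r) = rtrace (spectral U s) - rtrace (spectral V r)"
  then have "(\<Sum>i\<in>UNIV. \<Sum>j\<in>UNIV. t i j) = 0" using eq by simp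
  then have t0: "t i j = 0" for i j
    using t by (simp add: sum_nonneg_eq_0_iff sum_nonneg)
  define W where "W = conj_transpose U ** V"
  \<comment> \<open>Where \<open>W $ i $ j\<close> is nonzero its weight is positive, so the scalar
    equality case gives \<open>s i = r j\<close>. Hence \<open>W\<close> intertwines the two
    diagonal matrices.\<close>
  have "complex_of_real (s i) * W $ i $ j = W $ i $ j * complex_of_real (r j)" for i j
    using t0[of i j] diff_le_entropy(2)[OF sr, of i j]
    by (cases "W $ i $ j = 0") (auto simp: t_def overlap_def W_def)
  then have W: "real_diag s ** W = W ** real_diag r"
    by (simp add: vec_eq_iff real_diag_mult_nth mult_real_diag_nth)
  have "spectral U s = U ** (real_diag s ** W) ** conj_transpose V"
    using UV(2) by (simp add: W_def unitary_def matrix_mul_assoc[symmetric])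
  also have "\<dots> = spectral V r"
    unfolding W using UV(1) by (simp add: W_def unitary_def matrix_mul_assoc)
  finally show "spectral U s = spectral V r" .
qed

lemma klein_strict:
  assumes "pos_semidef \<sigma>" "pos_def \<rho>" "rtrace \<sigma> = rtrace \<rho>" "\<sigma> \<noteq> \<rho>"
  shows "0 < rel_entropy \<sigma> \<rho>"
proof -
  obtain U s where U: "unitary U" "\<sigma> = spectral U s" "\<And>i. 0 \<le> s i"
    using pos_semidef_diagonalization[OF assms(1)] by blast
  obtain V r where V: "unitary V" "\<rho> = spectral V r" "\<And>i. 0 < r i"
    using pos_def_diagonalization[OF assms(2)] by blast
  show ?thesis
    using klein_spectral[where s = s and r = r, OF U(1) V(1) U(3) V(3)] assms(3,4) U(2) V(2) by force
qed

lemma rel_entropy_self: "rel_entropy \<rho> \<rho> = 0"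
  by (simp add: rel_entropy_def trace_def)

text \<open>\<open>R\<close> is the inverse of \<open>\<rho>\<close>; the third scalar bound,
  weighted by overlaps, sums to the claim. Along a traceless direction from \<open>\<rho>\<close>
  the bound is quadratic in the step.\<close>

lemma rel_entropy_le_chi_square:
  assumes "pos_def \<rho>"
  obtains R where "\<rho> ** R = mat 1" "R ** \<rho> = mat 1"
    "\<And>\<sigma>. pos_semidef \<sigma> \<Longrightarrow> rel_entropy \<sigma> \<rho> \<le> rtrace (\<sigma> ** \<sigma> ** R) - rtrace \<sigma>"
proof -
  obtain V r where V: "unitary V" "\<rho> = spectral V r" "\<And>i. 0 < r i"
    using pos_def_diagonalization[OF assms(1)] by blast
  define R where "R = spectral V (\<lambda>i. 1 / r i)"
  have r: "r i \<noteq> 0" for i using V(3)[of i] by simp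
  have "\<rho> ** R = mat 1" "R ** \<rho> = mat 1"
    using V r by (simp_all add: R_def spectral_mult spectral_1)
  moreover have "rel_entropy \<sigma> \<rho> \<le> rtrace (\<sigma> ** \<sigma> ** R) - rtrace \<sigma>" if \<sigma>: "pos_semidef \<sigma>" for \<sigma>
  proof -
    obtain U s where U: "unitary U" "\<sigma> = spectral U s" "\<And>i. 0 \<le> s i"
      using pos_semidef_diagonalization[OF \<sigma>] by blast
    have "rel_entropy \<sigma> \<rho>
        \<le> (\<Sum>i\<in>UNIV. \<Sum>j\<in>UNIV. (s i * s i * (1 / r j) - s i) * overlap U V i j)"
      unfolding U(2) V(2) rel_entropy_spectral[OF U(1) V(1)]
      by (intro sum_mono mult_right_mono diff_le_entropy(3) U V overlap_nonneg)
    also have "\<dots> = rtrace (\<sigma> ** \<sigma> ** R) - rtrace \<sigma>"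
      unfolding U(2) R_def spectral_mult[OF U(1)] rtrace_spectral_mult
        rtrace_spectral_left[OF V(1), of U]
      by (simp add: sum_subtractf[symmetric] left_diff_distrib)
    finally show ?thesis .
  qed
  ultimately show ?thesis using that by blast
qed

section \<open>Minimizers of the entropy plus a linear functional\<close>

text \<open>The first term is the negative of the von Neumann entropy. The AB objective is the case
  \<open>K = - mat_log \<omega>\<close> with \<open>\<omega>\<close> the Gibbs update; the MD
  objective is \<open>\<gamma>\<close> times the case
  \<open>K = (1 / \<gamma>) *\<^sub>R G \<rho> - mat_log \<rho>\<close>.\<close>

definition free_energy :: "'n::finite cmat \<Rightarrow> 'n cmat \<Rightarrow> real" where
  "free_energy K \<sigma> = rtrace (\<sigma> ** mat_log \<sigma>) + rtrace (\<sigma> ** K)"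

section \<open>Lower semicontinuity and existence of minimizers\<close>

text \<open>Continuous minorants encode lower semicontinuity. Without a minimum each
  \<open>x\<close> has a better point \<open>y x\<close>, and the open sets where the minorant at
  \<open>x\<close> exceeds \<open>f (y x)\<close> cover \<open>S\<close>.\<close>

lemma attains_inf_of_continuous_minorants:
  fixes f :: "'a::topological_space \<Rightarrow> real"
  assumes "compact S" "S \<noteq> {}"
    and minorant: "\<And>x a. x \<in> S \<Longrightarrow> a < f x \<Longrightarrow>
      \<exists>g. continuous_on UNIV g \<and> (\<forall>y\<in>S. g y \<le> f y) \<and> a < g x"
  shows "\<exists>x\<in>S. \<forall>y\<in>S. f x \<le> f y"
proof (rule ccontr)
  assume "\<not> ?thesis"
  then have "\<forall>x\<in>S. \<exists>y\<in>S. f y < f x" by (meson not_le)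
  then obtain y where y: "\<And>x. x \<in> S \<Longrightarrow> y x \<in> S" "\<And>x. x \<in> S \<Longrightarrow> f (y x) < f x" by metis
  have "\<forall>x\<in>S. \<exists>g. continuous_on UNIV g \<and> (\<forall>z\<in>S. g z \<le> f z) \<and> f (y x) < g x"
    using minorant y(2) by blast
  then obtain g where g: "\<And>x. x \<in> S \<Longrightarrow> continuous_on UNIV (g x)"
    "\<And>x z. x \<in> S \<Longrightarrow> z \<in> S \<Longrightarrow> g x z \<le> f z" "\<And>x. x \<in> S \<Longrightarrow> f (y x) < g x x"
    by metis
  have "open {z. f (y x) < g x z}" if "x \<in> S" for x
    using g(1)[OF that] by (intro open_Collect_less continuous_on_const)
  moreover have "S \<subseteq> (\<Union>x\<in>S. {z. f (y x) < g x z})" using g(3) by blast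
  ultimately obtain C where C: "C \<subseteq> S" "finite C" "S \<subseteq> (\<Union>x\<in>C. {z. f (y x) < g x z})"
    by (rule compactE_image[OF assms(1)])
  have "C \<noteq> {}" using C(3) assms(2) by auto
  \<comment> \<open>Among finitely many better points the one of least value is taken; it lies in
    some set of the cover, whose own better point would be lower still.\<close>
  then obtain x where "is_arg_min (\<lambda>x. f (y x)) (\<lambda>x. x \<in> C) x"
    using ex_is_arg_min_if_finite[OF C(2)] by blast
  then have x: "x \<in> C" "\<And>z. z \<in> C \<Longrightarrow> f (y x) \<le> f (y z)"
    by (auto simp: is_arg_min_linorder)
  have "y x \<in> S" using x C y by blast
  then obtain z where z: "z \<in> C" "f (y z) < g z (y x)" using C(3) by blast
  then show False using g(2)[of z "y x"] x(2)[of z] C(1) \<open>y x \<in> S\<close> by fastforce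
qed

text \<open>By Klein's inequality the entropy \<open>Tr \<sigma> log \<sigma>\<close> is the supremum of the affine functions
  \<open>Tr \<sigma> log \<tau> + Tr \<sigma> - Tr \<tau>\<close>, so it is lower semicontinuous also at singular states.\<close>

lemma entropy_affine_minorant:
  fixes \<sigma> :: "'n::finite cmat"
  assumes "pos_semidef \<sigma>" "0 < e"
  obtains L c where
    "\<And>x. pos_semidef x \<Longrightarrow> rtrace (x ** L) + rtrace x - c \<le> rtrace (x ** mat_log x)"
    "rtrace (\<sigma> ** mat_log \<sigma>) - e \<le> rtrace (\<sigma> ** L) + rtrace \<sigma> - c"
proof -
  obtain U s where U: "unitary U" "\<sigma> = spectral U s" "\<And>i. 0 \<le> s i"
    using pos_semidef_diagonalization[OF assms(1)] by blast
  \<comment> \<open>The shift makes \<open>\<tau>\<close> positive definite yet diagonal in the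
    eigenbasis of \<open>\<sigma>\<close>; over all eigenvalues it adds exactly \<open>e\<close> to
    the trace.\<close>
  define d where "d = e / real CARD('n)"
  have d: "0 < d" using assms(2) by (simp add: d_def)
  define \<tau> where "\<tau> = spectral U (\<lambda>i. s i + d)"
  have pos: "0 < s i + d" for i using U(3)[of i] d by simp
  show ?thesis
  proof
    fix x :: "'n cmat" assume "pos_semidef x"
    then obtain V r where V: "unitary V" "x = spectral V r" "\<And>i. 0 \<le> r i"
      using pos_semidef_diagonalization by blast
    have "rtrace x - rtrace \<tau> \<le> rel_entropy x \<tau>"
      unfolding V(2) \<tau>_def by (rule klein_spectral(1)[OF V(1) U(1) V(3) pos])
    then show "rtrace (x ** mat_log \<tau>) + rtrace x - rtrace \<tau> \<le> rtrace (x ** mat_log x)"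
      by (simp add: rel_entropy_def mm.diff_right rtrace_simps)
  next
    have "rtrace (\<sigma> ** mat_log \<sigma>) = (\<Sum>i\<in>UNIV. s i * ln (s i))"
      unfolding U(2) mat_log_spectral[OF U(1)] spectral_mult[OF U(1)] rtrace_spectral[OF U(1)] ..
    also have "\<dots> \<le> (\<Sum>i\<in>UNIV. s i * ln (s i + d))"
    proof (rule sum_mono)
      fix i
      show "s i * ln (s i) \<le> s i * ln (s i + d)"
        using U(3)[of i] d by (cases "s i = 0") (auto intro!: mult_left_mono)
    qed
    also have "\<dots> = rtrace (\<sigma> ** mat_log \<tau>)"
      unfolding U(2) \<tau>_def mat_log_spectral[OF U(1)] spectral_mult[OF U(1)]
        rtrace_spectral[OF U(1)] ..
    finally have "rtrace (\<sigma> ** mat_log \<sigma>) \<le> rtrace (\<sigma> ** mat_log \<tau>)" .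
    moreover have "rtrace \<tau> = rtrace \<sigma> + e"
      unfolding U(2) \<tau>_def rtrace_spectral[OF U(1)] by (simp add: sum.distrib d_def)
    ultimately show "rtrace (\<sigma> ** mat_log \<sigma>) - e
        \<le> rtrace (\<sigma> ** mat_log \<tau>) + rtrace \<sigma> - rtrace \<tau>" by simp
  qed
qed

lemma continuous_on_rtrace_mult [continuous_intros]:
  fixes K :: "'n::finite cmat"
  shows "continuous_on S (\<lambda>x. rtrace (x ** K))"
  by (rule linear_continuous_on[OF bounded_linear_compose[OF bounded_linear_rtrace
        mm.bounded_linear_left]])

lemma free_energy_attains_inf:
  fixes M :: "'n::finite cmat set"
  assumes "compact M" "M \<noteq> {}" "\<And>\<sigma>. \<sigma> \<in> M \<Longrightarrow> pos_semidef \<sigma>"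
  shows "\<exists>\<sigma>\<in>M. \<forall>\<tau>\<in>M. free_energy K \<sigma> \<le> free_energy K \<tau>"
proof (rule attains_inf_of_continuous_minorants[OF assms(1,2)])
  fix \<sigma> a assume \<sigma>: "\<sigma> \<in> M" and a: "a < free_energy K \<sigma>"
  \<comment> \<open>Half of the gap above \<open>a\<close> is allowed as error, so the minorant
    still exceeds \<open>a\<close> at \<open>\<sigma>\<close>.\<close>
  obtain L c where L:
    "\<And>x. pos_semidef x \<Longrightarrow> rtrace (x ** L) + rtrace x - c \<le> rtrace (x ** mat_log x)"
    "rtrace (\<sigma> ** mat_log \<sigma>) - (free_energy K \<sigma> - a) / 2 \<le> rtrace (\<sigma> ** L) + rtrace \<sigma> - c"
    using entropy_affine_minorant[OF assms(3)[OF \<sigma>], of "(free_energy K \<sigma> - a) / 2"] a by auto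
  show "\<exists>g. continuous_on UNIV g \<and> (\<forall>y\<in>M. g y \<le> free_energy K y) \<and> a < g \<sigma>"
  proof (intro exI conjI ballI)
    let ?g = "\<lambda>x. rtrace (x ** L) + rtrace (x ** mat 1) - c + rtrace (x ** K)"
    show "continuous_on UNIV ?g" by (intro continuous_intros)
    show "?g y \<le> free_energy K y" if "y \<in> M" for y
      using L(1) assms(3) that by (simp add: free_energy_def)
    show "a < ?g \<sigma>"
      using L(2) a by (simp add: free_energy_def field_simps)
  qed
qed

section \<open>Interior directions and compactness of the linear family\<close>

text \<open>\<open>m\<close> is the smallest eigenvalue, so
  \<open>\<rho> - m *\<^sub>R mat 1\<close> has nonnegative spectrum.\<close>

lemma pos_def_lower_bound:
  assumes "pos_def \<rho>"
  obtains m where "0 < m" "\<And>x. m * (x \<bullet> x) \<le> x \<bullet> (\<rho> *v x)"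
proof -
  obtain V r where V: "unitary V" "\<rho> = spectral V r" "\<And>i. 0 < r i"
    using pos_def_diagonalization[OF assms] by blast
  define m where "m = Min (range r)"
  have "0 < m" "\<And>i. m \<le> r i" using V(3) by (auto simp: m_def)
  moreover have "m * (x \<bullet> x) \<le> x \<bullet> (\<rho> *v x)" for x
  proof -
    have "pos_semidef (spectral V (\<lambda>i. r i - m * 1))"
      using \<open>\<And>i. m \<le> r i\<close> by (intro pos_semidef_spectral) simp
    then have "pos_semidef (\<rho> - m *\<^sub>R mat 1)"
      unfolding spectral_diff spectral_scaleR spectral_1[OF V(1)] V(2) .
    then show ?thesis
      by (simp add: pos_semidef_def matrix_vector_mult_diff_rdistrib inner_diff_right
          scaleR_cmat_vector)
  qed
  ultimately show ?thesis using that by blast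
qed

text \<open>The form of \<open>t *\<^sub>R X\<close> is bounded by \<open>\<bar>t\<bar> * B\<close>
  times the squared norm, which the lower bound of \<open>\<rho>\<close> absorbs once
  \<open>\<bar>t\<bar> \<le> m / B\<close>.\<close>

lemma pos_semidef_perturbation:
  assumes "pos_def \<rho>" "hermitian X"
  obtains \<epsilon> where "0 < \<epsilon>" "\<And>t. \<bar>t\<bar> \<le> \<epsilon> \<Longrightarrow> pos_semidef (\<rho> + t *\<^sub>R X)"
proof -
  obtain m where m: "0 < m" "\<And>x. m * (x \<bullet> x) \<le> x \<bullet> (\<rho> *v x)"
    using pos_def_lower_bound[OF assms(1)] by blast
  obtain B where B: "0 < B" "\<And>x. norm (X *v x) \<le> norm x * B"
    using bounded_linear.pos_bounded[OF matrix_vector_mul_bounded_linear[of X]] by blast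
  have "pos_semidef (\<rho> + t *\<^sub>R X)" if t: "\<bar>t\<bar> \<le> m / B" for t
    unfolding pos_semidef_def
  proof (intro conjI allI)
    show "hermitian (\<rho> + t *\<^sub>R X)"
      using assms by (simp add: hermitian_add hermitian_scaleR pos_def_def)
    fix x
    have "\<bar>x \<bullet> (X *v x)\<bar> \<le> norm x * norm (X *v x)" by (rule Cauchy_Schwarz_ineq2)
    also have "\<dots> \<le> norm x * (norm x * B)" by (intro mult_left_mono B) simp
    finally have "\<bar>t\<bar> * \<bar>x \<bullet> (X *v x)\<bar> \<le> m / B * (norm x * (norm x * B))"
      using t m B by (intro mult_mono) auto
    also have "\<dots> = m * (x \<bullet> x)"
      using B(1) by (simp add: power2_eq_square flip: power2_norm_eq_inner)
    finally have "\<bar>t * (x \<bullet> (X *v x))\<bar> \<le> x \<bullet> (\<rho> *v x)" using m(2)[of x] by (simp add: abs_mult)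
    then show "0 \<le> x \<bullet> ((\<rho> + t *\<^sub>R X) *v x)"
      by (simp add: matrix_vector_mult_add_rdistrib inner_add_right
          scaleR_cmat_vector)
  qed
  then show ?thesis using that[of "m / B"] m(1) B(1) by simp
qed

lemma trace_add_scaleR:
  fixes A B :: "'n::finite cmat"
  shows "trace (A + t *\<^sub>R B) = trace A + t *\<^sub>R trace B"
  by (simp add: trace_def sum.distrib scaleR_sum_right)

text \<open>The linear constraints persist along \<open>X\<close>, and positivity persists for small
  \<open>t\<close>. Both signs of \<open>t\<close> occur, which turns optimality into an
  equation.\<close>

lemma lin_family_line:
  assumes \<rho>: "\<rho> \<in> lin_family_pos k H c" and X: "X \<in> tangent_subspace k H"
  obtains \<epsilon> where "0 < \<epsilon>" "\<And>t. \<bar>t\<bar> \<le> \<epsilon> \<Longrightarrow> \<rho> + t *\<^sub>R X \<in> lin_family k H c"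
proof -
  obtain \<epsilon> where "0 < \<epsilon>" "\<And>t. \<bar>t\<bar> \<le> \<epsilon> \<Longrightarrow> pos_semidef (\<rho> + t *\<^sub>R X)"
    using pos_semidef_perturbation[of \<rho> X] \<rho> X
    by (auto simp: lin_family_pos_def tangent_subspace_def)
  then show ?thesis
    using \<rho> X by (intro that[of \<epsilon>])
      (auto simp: lin_family_pos_def lin_family_def density_ops_def tangent_subspace_def
        mm.add_left mm.scaleR_left trace_add_scaleR)
qed

text \<open>Every defining condition is closed, with positivity imposed one vector at a time. The
  eigenvalues of a state are nonnegative with sum one, which bounds its Frobenius norm by
  one.\<close>

lemma compact_lin_family: "compact (lin_family k H c :: 'n::finite cmat set)"
proof -
  have tr: "continuous_on UNIV (\<lambda>A :: 'n cmat. trace A)"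
    unfolding trace_def by (intro continuous_intros)
  have trH: "continuous_on UNIV (\<lambda>A :: 'n cmat. trace (A ** B))" for B
    unfolding trace_def matrix_matrix_mult_def by (simp, intro continuous_intros)
  have form: "continuous_on UNIV (\<lambda>A :: 'n cmat. x \<bullet> (A *v x))" for x
    by (intro continuous_intros bounded_linear.continuous_on[OF bounded_linear_matrix_vector_left])
  have "lin_family k H c = {A. hermitian A} \<inter> (\<Inter>x. {A. 0 \<le> x \<bullet> (A *v x)}) \<inter> {A. trace A = 1}
      \<inter> (\<Inter>j\<in>{1..k}. {A. trace (A ** H j) = complex_of_real (c j)})"
    by (auto simp: lin_family_def density_ops_def pos_semidef_def)
  also have "closed \<dots>"
    by (intro closed_Int closed_INT ballI closed_subspace subspace_hermitian closed_Collect_le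
        closed_Collect_eq continuous_on_const tr trH form)
  finally have "closed (lin_family k H c)" .
  moreover have "bounded (lin_family k H c)"
    unfolding bounded_iff
  proof (intro exI[of _ 1] ballI)
    fix A assume "A \<in> lin_family k H c"
    then have A: "pos_semidef A" "trace A = 1" by (auto simp: lin_family_def density_ops_def)
    obtain U s where U: "unitary U" "A = spectral U s" "\<And>i. 0 \<le> s i"
      using pos_semidef_diagonalization[OF A(1)] by blast
    have s1: "(\<Sum>i\<in>UNIV. s i) = 1"
      using rtrace_spectral[OF U(1), of s] A(2) U(2) by simp
    have "(norm A)\<^sup>2 = rtrace (A ** A)"
      using trace_mult_hermitian[of A A] A(1) by (simp add: power2_norm_eq_inner pos_semidef_def)
    also have "\<dots> = (\<Sum>i\<in>UNIV. s i * s i)"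
      unfolding U(2) spectral_mult[OF U(1)] rtrace_spectral[OF U(1)] ..
    also have "\<dots> \<le> (\<Sum>i\<in>UNIV. s i * 1)"
      using U(3) s1 member_le_sum[of _ UNIV s] by (intro sum_mono mult_left_mono) auto
    finally show "norm A \<le> 1" using s1 by (simp add: power_le_one_iff abs_square_le_1)
  qed
  ultimately show ?thesis by (simp add: compact_eq_bounded_closed)
qed

lemma lin_family_pos_semidef: "\<sigma> \<in> lin_family k H c \<Longrightarrow> pos_semidef \<sigma>"
  and lin_family_rtrace: "\<sigma> \<in> lin_family k H c \<Longrightarrow> rtrace \<sigma> = 1"
  by (auto simp: lin_family_def density_ops_def)

lemma lin_family_diff_tangent:
  assumes "\<sigma> \<in> lin_family k H c" "\<rho> \<in> lin_family k H c"
  shows "\<sigma> - \<rho> \<in> tangent_subspace k H"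
  using assms
  by (auto simp: lin_family_def density_ops_def pos_semidef_def tangent_subspace_def
      hermitian_diff mm.diff_left trace_sub)

text \<open>Comparison with nearby points of a line leaves a linear term plus a quadratic remainder
  that is nonnegative for small \<open>t\<close> of either sign.\<close>

lemma free_energy_first_order:
  assumes \<rho>: "\<rho> \<in> lin_family_pos k H c"
    and min: "\<And>\<sigma>. \<sigma> \<in> lin_family k H c \<Longrightarrow> free_energy K \<rho> \<le> free_energy K \<sigma>"
    and X: "X \<in> tangent_subspace k H"
  shows "rtrace (X ** (mat_log \<rho> + K)) = 0"
proof -
  obtain \<epsilon> where \<epsilon>: "0 < \<epsilon>" "\<And>t. \<bar>t\<bar> \<le> \<epsilon> \<Longrightarrow> \<rho> + t *\<^sub>R X \<in> lin_family k H c"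
    using lin_family_line[OF \<rho> X] by blast
  obtain R where R: "\<rho> ** R = mat 1" "R ** \<rho> = mat 1"
    and chi: "\<And>\<sigma>. pos_semidef \<sigma> \<Longrightarrow> rel_entropy \<sigma> \<rho> \<le> rtrace (\<sigma> ** \<sigma> ** R) - rtrace \<sigma>"
    using rel_entropy_le_chi_square[of \<rho>] \<rho> by (auto simp: lin_family_pos_def)
  have X0: "rtrace X = 0" using X by (simp add: tangent_subspace_def)
  have "0 \<le> t * rtrace (X ** (mat_log \<rho> + K)) + rtrace (X ** X ** R) * t\<^sup>2" if t: "\<bar>t\<bar> \<le> \<epsilon>" for t
  proof -
    define \<sigma> where "\<sigma> = \<rho> + t *\<^sub>R X"
    \<comment> \<open>Both cross terms of \<open>\<sigma> ** \<sigma> ** R\<close> have the trace of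
      \<open>X\<close>, which is zero; for this one cyclicity is required.\<close>
    have "trace (\<rho> ** (X ** R)) = trace ((X ** R) ** \<rho>)" by (rule trace_mul_sym)
    also have "\<dots> = trace X" by (simp add: matrix_mul_assoc[symmetric] R)
    finally have "rtrace (\<rho> ** X ** R) = 0" using X0 by (simp add: matrix_mul_assoc)
    moreover have "\<rho> ** \<rho> ** R = \<rho>" "X ** \<rho> ** R = X" by (simp_all add: matrix_mul_assoc[symmetric] R)
    ultimately have eq: "rtrace (\<sigma> ** \<sigma> ** R) - rtrace \<sigma> = rtrace (X ** X ** R) * t\<^sup>2"
      by (simp add: \<sigma>_def mm.add_left mm.add_right mm.scaleR_left mm.scaleR_right rtrace_simps X0
          power2_eq_square)
    have "0 \<le> free_energy K \<sigma> - free_energy K \<rho>"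
      using min[OF \<epsilon>(2)[OF t]] by (simp add: \<sigma>_def)
    \<comment> \<open>An exact identity: beyond its linear part, the change of the free energy is
      the relative entropy itself.\<close>
    also have "\<dots> = t * rtrace (X ** (mat_log \<rho> + K)) + rel_entropy \<sigma> \<rho>"
    proof -
      have "rtrace (\<sigma> ** mat_log \<rho>) = rtrace (\<rho> ** mat_log \<rho>) + t * rtrace (X ** mat_log \<rho>)"
        and "rtrace (\<sigma> ** K) = rtrace (\<rho> ** K) + t * rtrace (X ** K)"
        unfolding \<sigma>_def by (simp_all add: mm.add_left mm.scaleR_left rtrace_simps)
      then show ?thesis
        by (simp add: free_energy_def rel_entropy_def mm.add_right mm.diff_right rtrace_simps
            algebra_simps)
    qed
    also have "rel_entropy \<sigma> \<rho> \<le> rtrace (X ** X ** R) * t\<^sup>2"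
      using chi[of \<sigma>] lin_family_pos_semidef[OF \<epsilon>(2)[OF t]] eq by (simp add: \<sigma>_def)
    finally show ?thesis by simp
  qed
  with \<epsilon>(1) show ?thesis by (rule linear_term_zero)
qed

section \<open>Fixed points\<close>

lemma normal_subspace_iff:
  assumes "hermitian Y"
  shows "Y \<in> normal_subspace k H \<longleftrightarrow> (\<forall>X\<in>tangent_subspace k H. rtrace (X ** Y) = 0)"
  using assms trace_mult_hermitian[of _ Y]
  by (auto simp: normal_subspace_def tangent_subspace_def)

text \<open>Since \<open>arg_min_on\<close> is a Hilbert choice, its value is known to be minimal
  only after some minimizer has been exhibited.\<close>

lemma arg_min_on_attained:
  fixes f :: "'a \<Rightarrow> real"
  assumes "\<exists>x\<in>S. \<forall>y\<in>S. f x \<le> f y"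
  shows "arg_min_on f S \<in> S" "\<And>y. y \<in> S \<Longrightarrow> f (arg_min_on f S) \<le> f y"
proof -
  have "\<exists>x. is_arg_min f (\<lambda>x. x \<in> S) x" using assms by (auto simp: is_arg_min_linorder)
  then have "is_arg_min f (\<lambda>x. x \<in> S) (arg_min_on f S)"
    unfolding arg_min_on_def arg_min_def by (rule someI_ex)
  then show "arg_min_on f S \<in> S" "\<And>y. y \<in> S \<Longrightarrow> f (arg_min_on f S) \<le> f y"
    by (auto simp: is_arg_min_linorder)
qed

lemma hermitian_mat_log:
  assumes "hermitian A"
  shows "hermitian (mat_log A)"
proof -
  obtain U d where "unitary U" "A = spectral U d"
    using hermitian_diagonalization[OF assms] by blast
  then show ?thesis by (simp add: mat_log_spectral hermitian_spectral)
qed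

text \<open>In an eigenbasis of the exponent the logarithm undoes the exponential. Normalization
  only subtracts a multiple of the identity, which pairs to zero with traceless directions.\<close>

lemma mat_log_gibbs_update:
  fixes \<rho> :: "'n::finite cmat"
  assumes "hermitian \<rho>" "hermitian (\<Omega> \<rho>)"
  obtains z where "mat_log (gibbs_update \<gamma> \<Omega> \<rho>) = mat_log \<rho> - (1 / \<gamma>) *\<^sub>R \<Omega> \<rho> - z *\<^sub>R mat 1"
proof -
  define A where "A = mat_log \<rho> - (1 / \<gamma>) *\<^sub>R \<Omega> \<rho>"
  have "hermitian A"
    unfolding A_def by (intro hermitian_diff hermitian_scaleR hermitian_mat_log assms)
  then obtain U a where U: "unitary U" "A = spectral U a"
    using hermitian_diagonalization by blast
  define Z where "Z = (\<Sum>i\<in>UNIV. exp (a i))"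
  have Z: "0 < Z" unfolding Z_def by (intro sum_pos) auto
  have "gibbs_update \<gamma> \<Omega> \<rho> = spectral U (\<lambda>i. (1 / Z) * exp (a i))"
    unfolding gibbs_update_def A_def[symmetric] U(2) mat_exp_spectral[OF U(1)] Let_def
      rtrace_spectral[OF U(1)] spectral_scaleR Z_def ..
  then have "mat_log (gibbs_update \<gamma> \<Omega> \<rho>) = spectral U (\<lambda>i. a i - ln Z * 1)"
    using Z by (simp add: mat_log_spectral[OF U(1)] ln_div)
  also have "\<dots> = A - ln Z *\<^sub>R mat 1"
    unfolding spectral_diff spectral_scaleR spectral_1[OF U(1)] U(2) ..
  finally show ?thesis unfolding A_def by (rule that)
qed

lemma rel_entropy_eq_free_energy: "rel_entropy \<sigma> \<rho> = free_energy (- mat_log \<rho>) \<sigma>"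
  by (simp add: rel_entropy_def free_energy_def mm.diff_right mm.minus_right rtrace_simps)

text \<open>In the first-order condition with \<open>K = - mat_log \<omega>\<close> the two copies
  of \<open>mat_log \<rho>\<close> cancel, leaving
  \<open>(1 / \<gamma>) *\<^sub>R \<Omega> \<rho>\<close> plus a multiple of the identity.\<close>

lemma T_AB_fixed_point_normal:
  assumes \<rho>: "\<rho> \<in> lin_family_pos k H c" and \<Omega>: "hermitian (\<Omega> \<rho>)" and "0 < \<gamma>"
    and fixed: "T_AB (lin_family k H c) \<gamma> \<Omega> \<rho> = \<rho>"
  shows "\<Omega> \<rho> \<in> normal_subspace k H"
proof -
  have \<rho>M: "\<rho> \<in> lin_family k H c" and "hermitian \<rho>"
    using \<rho> by (auto simp: lin_family_pos_def pos_def_def)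
  define \<omega> where "\<omega> = gibbs_update \<gamma> \<Omega> \<rho>"
  obtain z where z: "mat_log \<omega> = mat_log \<rho> - (1 / \<gamma>) *\<^sub>R \<Omega> \<rho> - z *\<^sub>R mat 1"
    using mat_log_gibbs_update[where \<gamma> = \<gamma> and \<Omega> = \<Omega>, OF \<open>hermitian \<rho>\<close> \<Omega>] by (auto simp: \<omega>_def)
  \<comment> \<open>Existence makes the chosen point in \<open>fixed\<close> a genuine
    minimizer.\<close>
  have "\<exists>\<sigma>\<in>lin_family k H c. \<forall>\<tau>\<in>lin_family k H c. rel_entropy \<sigma> \<omega> \<le> rel_entropy \<tau> \<omega>"
    unfolding rel_entropy_eq_free_energy
    using \<rho>M by (intro free_energy_attains_inf compact_lin_family) (auto intro: lin_family_pos_semidef)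
  then have "rel_entropy \<rho> \<omega> \<le> rel_entropy \<sigma> \<omega>" if "\<sigma> \<in> lin_family k H c" for \<sigma>
    using arg_min_on_attained(2)[of "lin_family k H c" "\<lambda>\<sigma>. rel_entropy \<sigma> \<omega>"] that fixed
    by (simp add: T_AB_def \<omega>_def)
  then have grad0: "rtrace (X ** (mat_log \<rho> + - mat_log \<omega>)) = 0" if "X \<in> tangent_subspace k H" for X
    using free_energy_first_order[OF \<rho> _ that] by (simp only: rel_entropy_eq_free_energy)
  have "rtrace (X ** ((1 / \<gamma>) *\<^sub>R \<Omega> \<rho> + z *\<^sub>R mat 1)) = 0" if "X \<in> tangent_subspace k H" for X
  proof -
    have "mat_log \<rho> + - mat_log \<omega> = (1 / \<gamma>) *\<^sub>R \<Omega> \<rho> + z *\<^sub>R mat 1" by (simp add: z)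
    then show ?thesis using grad0[OF that] by simp
  qed
  then have "rtrace (X ** \<Omega> \<rho>) = 0" if "X \<in> tangent_subspace k H" for X
    using that \<open>0 < \<gamma>\<close>
    by (fastforce simp: mm.add_right mm.scaleR_right rtrace_simps tangent_subspace_def)
  then show ?thesis using \<Omega> by (simp add: normal_subspace_iff)
qed

lemma T_MD_fixed_point_iff:
  assumes \<rho>: "\<rho> \<in> lin_family_pos k H c" and G: "hermitian (G \<rho>)" and "0 < \<gamma>"
  shows "T_MD (lin_family k H c) \<gamma> G \<rho> = \<rho> \<longleftrightarrow> G \<rho> \<in> normal_subspace k H"
proof -
  let ?M = "lin_family k H c"
  let ?h = "\<lambda>\<sigma>. rtrace (\<sigma> ** G \<rho>) + \<gamma> * rel_entropy \<sigma> \<rho>"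
  have \<rho>M: "\<rho> \<in> ?M" and pd: "pos_def \<rho>" using \<rho> by (auto simp: lin_family_pos_def)
  \<comment> \<open>With this \<open>K\<close> the MD objective is \<open>\<gamma>\<close> times the
    free energy, and \<open>mat_log \<rho> + K\<close> collapses to
    \<open>(1 / \<gamma>) *\<^sub>R G \<rho>\<close>.\<close>
  define K where "K = (1 / \<gamma>) *\<^sub>R G \<rho> - mat_log \<rho>"
  have h: "?h \<sigma> = \<gamma> * free_energy K \<sigma>" for \<sigma>
    using \<open>0 < \<gamma>\<close>
    by (simp add: K_def free_energy_def rel_entropy_def mm.diff_right mm.scaleR_right
        rtrace_simps field_simps)
  have "\<exists>\<sigma>\<in>?M. \<forall>\<tau>\<in>?M. free_energy K \<sigma> \<le> free_energy K \<tau>"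
    using \<rho>M by (intro free_energy_attains_inf compact_lin_family) (auto intro: lin_family_pos_semidef)
  then have ex: "\<exists>\<sigma>\<in>?M. \<forall>\<tau>\<in>?M. ?h \<sigma> \<le> ?h \<tau>"
    unfolding h using \<open>0 < \<gamma>\<close> by simp
  show ?thesis
  proof
    assume "T_MD ?M \<gamma> G \<rho> = \<rho>"
    then have "arg_min_on ?h ?M = \<rho>" by (simp add: T_MD_def)
    then have "?h \<rho> \<le> ?h \<sigma>" if "\<sigma> \<in> ?M" for \<sigma>
      using arg_min_on_attained(2)[OF ex that] by simp
    then have "free_energy K \<rho> \<le> free_energy K \<sigma>" if "\<sigma> \<in> ?M" for \<sigma>
      using that \<open>0 < \<gamma>\<close> unfolding h by simp
    from free_energy_first_order[OF \<rho> this] \<open>0 < \<gamma>\<close>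
    have "rtrace (X ** G \<rho>) = 0" if "X \<in> tangent_subspace k H" for X
      using that by (simp add: K_def mm.scaleR_right rtrace_simps)
    then show "G \<rho> \<in> normal_subspace k H" using G by (simp add: normal_subspace_iff)
  next
    assume N: "G \<rho> \<in> normal_subspace k H"
    \<comment> \<open>The chosen minimizer has to be identified with \<open>\<rho>\<close>. As
      \<open>G \<rho>\<close> pairs equally with both, comparing \<open>?h\<close> leaves
      \<open>rel_entropy \<sigma> \<rho> \<le> 0\<close>.\<close>
    define \<sigma> where "\<sigma> = arg_min_on ?h ?M"
    have \<sigma>: "\<sigma> \<in> ?M" "?h \<sigma> \<le> ?h \<rho>"
      unfolding \<sigma>_def using arg_min_on_attained[OF ex] \<rho>M by blast+
    have "rtrace ((\<sigma> - \<rho>) ** G \<rho>) = 0"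
      using N lin_family_diff_tangent[OF \<sigma>(1) \<rho>M] G by (simp add: normal_subspace_iff)
    then have "rtrace (\<sigma> ** G \<rho>) = rtrace (\<rho> ** G \<rho>)" by (simp add: mm.diff_left rtrace_simps)
    then have "rel_entropy \<sigma> \<rho> \<le> 0"
      using \<sigma>(2) \<open>0 < \<gamma>\<close> by (simp add: rel_entropy_self mult_le_0_iff)
    then have "\<sigma> = \<rho>"
      using klein_strict[OF lin_family_pos_semidef[OF \<sigma>(1)] pd]
        lin_family_rtrace[OF \<sigma>(1)] lin_family_rtrace[OF \<rho>M] by fastforce
    then show "T_MD ?M \<gamma> G \<rho> = \<rho>" by (simp add: T_MD_def \<sigma>_def)
  qed
qed

section \<open>Optimality of a convex function on the linear family\<close>

text \<open>The chain rule, within the part of a line that lies in \<open>M\<close>.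
  \<open>S\<close> will be an open interval around zero for minimality and \<open>{0..1}\<close> for
  convexity.\<close>

lemma has_real_derivative_along_line:
  fixes M :: "'n::finite cmat set"
  assumes "is_gradient_on M f G" "\<rho> \<in> M" "\<And>t. t \<in> S \<Longrightarrow> \<rho> + t *\<^sub>R X \<in> M"
  shows "((\<lambda>t. f (\<rho> + t *\<^sub>R X)) has_real_derivative rtrace (X ** G \<rho>)) (at 0 within S)"
proof -
  let ?g = "\<lambda>t. \<rho> + t *\<^sub>R X"
  have "(f has_derivative (\<lambda>Y. rtrace (G \<rho> ** Y))) (at \<rho> within M)"
    using assms(1,2) by (simp add: is_gradient_on_def)
  then have "(f has_derivative (\<lambda>Y. rtrace (G \<rho> ** Y))) (at (?g 0) within ?g ` S)"
    using assms(3) by (auto intro: has_derivative_subset)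
  moreover have "(?g has_derivative (\<lambda>t. t *\<^sub>R X)) (at 0 within S)"
    by (auto intro!: derivative_eq_intros)
  ultimately have "((\<lambda>t. f (?g t)) has_derivative (\<lambda>t. rtrace (G \<rho> ** (t *\<^sub>R X)))) (at 0 within S)"
    by (rule has_derivative_in_compose[rotated])
  moreover have "rtrace (G \<rho> ** (t *\<^sub>R X)) = rtrace (X ** G \<rho>) * t" for t
    using trace_mul_sym[of X "G \<rho>"] by (simp add: mm.scaleR_right rtrace_simps)
  ultimately show ?thesis by (simp add: has_field_derivative_def)
qed

lemma convex_minimizer_iff_gradient_normal:
  assumes \<rho>: "\<rho> \<in> lin_family_pos k H c"
    and conv: "convex_on (lin_family k H c) f" and grad: "is_gradient_on (lin_family k H c) f G"
  shows "(\<forall>\<sigma>\<in>lin_family k H c. f \<rho> \<le> f \<sigma>) \<longleftrightarrow> G \<rho> \<in> normal_subspace k H"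
proof
  let ?M = "lin_family k H c"
  have \<rho>M: "\<rho> \<in> ?M" using \<rho> by (simp add: lin_family_pos_def)
  have G: "hermitian (G \<rho>)" using grad \<rho>M by (simp add: is_gradient_on_def)
  {
    assume min: "\<forall>\<sigma>\<in>?M. f \<rho> \<le> f \<sigma>"
    have "rtrace (X ** G \<rho>) = 0" if X: "X \<in> tangent_subspace k H" for X
    proof -
      obtain \<epsilon> where \<epsilon>: "0 < \<epsilon>" "\<And>t. \<bar>t\<bar> \<le> \<epsilon> \<Longrightarrow> \<rho> + t *\<^sub>R X \<in> ?M"
        using lin_family_line[OF \<rho> X] by blast
      have "((\<lambda>t. f (\<rho> + t *\<^sub>R X)) has_real_derivative rtrace (X ** G \<rho>)) (at 0 within {-\<epsilon><..<\<epsilon>})"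
        by (rule has_real_derivative_along_line[OF grad \<rho>M]) (auto intro: \<epsilon>(2))
      \<comment> \<open>On an open interval the derivative within the set is the ordinary one, as
        the local minimum criterion requires.\<close>
      then have "((\<lambda>t. f (\<rho> + t *\<^sub>R X)) has_real_derivative rtrace (X ** G \<rho>)) (at 0)"
        using \<epsilon>(1) by (simp add: at_within_open[of _ "{-\<epsilon><..<\<epsilon>}"])
      then show ?thesis
        by (rule DERIV_local_min[OF _ \<epsilon>(1)]) (use min \<epsilon>(2) in auto)
    qed
    then show "G \<rho> \<in> normal_subspace k H" using G by (simp add: normal_subspace_iff)
  next
    assume N: "G \<rho> \<in> normal_subspace k H"
    show "\<forall>\<sigma>\<in>?M. f \<rho> \<le> f \<sigma>"
    proof
      fix \<sigma> assume \<sigma>: "\<sigma> \<in> ?M"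
      let ?g = "\<lambda>t. f (\<rho> + t *\<^sub>R (\<sigma> - \<rho>))"
      have line: "\<rho> + t *\<^sub>R (\<sigma> - \<rho>) = (1 - t) *\<^sub>R \<rho> + t *\<^sub>R \<sigma>" for t
        by (simp add: algebra_simps)
      \<comment> \<open>\<open>convex_on\<close> includes convexity of the set, so
        \<open>conv\<close> yields both membership of the segment and the chord bound.\<close>
      have M: "\<rho> + t *\<^sub>R (\<sigma> - \<rho>) \<in> ?M" and le: "?g t \<le> (1 - t) * f \<rho> + t * f \<sigma>"
        if "t \<in> {0..1}" for t
        unfolding line using conv \<rho>M \<sigma> that by (auto simp: convex_on_def convex_def)
      have "rtrace ((\<sigma> - \<rho>) ** G \<rho>) = 0"
        using N lin_family_diff_tangent[OF \<sigma> \<rho>M] G by (simp add: normal_subspace_iff)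
      then have "(?g has_real_derivative 0) (at 0 within {0..1})"
        using has_real_derivative_along_line[OF grad \<rho>M M] by metis
      then have "((\<lambda>t. (?g t - f \<rho>) / t) \<longlongrightarrow> 0) (at 0 within {0..1})"
        by (simp add: has_field_derivative_iff)
      \<comment> \<open>By convexity the difference quotients stay below the slope of the full
        chord; as they tend to zero, that slope is nonnegative.\<close>
      moreover have "\<forall>\<^sub>F t in at 0 within {0..1}. (?g t - f \<rho>) / t \<le> f \<sigma> - f \<rho>"
        unfolding eventually_at_filter
      proof (intro always_eventually allI impI)
        fix t :: real assume "t \<noteq> 0" "t \<in> {0..1}"
        then have t: "0 < t" "t \<in> {0..1}" by auto
        have "?g t - f \<rho> \<le> (f \<sigma> - f \<rho>) * t"
          using le[OF t(2)] by (simp only: left_diff_distrib) (simp add: mult.commute)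
        with t(1) show "(?g t - f \<rho>) / t \<le> f \<sigma> - f \<rho>" by (simp only: pos_divide_le_eq)
      qed
      moreover have "at 0 within {0..1::real} \<noteq> bot"
        by (simp add: trivial_limit_within islimpt_Icc)
      ultimately have "0 \<le> f \<sigma> - f \<rho>" by (intro tendsto_upperbound)
      then show "f \<rho> \<le> f \<sigma>" by simp
    qed
  }
qed
theorem theorem12:
  fixes k :: nat
    and H :: "nat \<Rightarrow> complex^'n::finite^'n"
    and c :: "nat \<Rightarrow> real"
    and \<Omega> gradf :: "complex^'n^'n \<Rightarrow> complex^'n^'n"
    and \<gamma> :: real
    and \<rho>s :: "complex^'n^'n"
  assumes "\<forall>j\<in>{1..k}. hermitian (H j)"
    and "inj_on H {1..k}" and "mat 1 \<notin> H ` {1..k}"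
    and "independent (insert (mat 1) (H ` {1..k}))"
    and "lin_family_pos k H c \<noteq> {}"
    and "\<forall>\<rho>\<in>density_ops. hermitian (\<Omega> \<rho>)" and "continuous_on density_ops \<Omega>"
    and "\<gamma> > 0"
    and "convex_on (lin_family k H c) (objective \<Omega>)"
    and "is_gradient_on (lin_family k H c) (objective \<Omega>) gradf"
    and "\<rho>s \<in> lin_family_pos k H c"
    and "T_AB (lin_family k H c) \<gamma> \<Omega> \<rho>s = \<rho>s"
  shows "((\<forall>\<sigma>\<in>lin_family k H c. objective \<Omega> \<rho>s \<le> objective \<Omega> \<sigma>) \<longleftrightarrow> T_MD (lin_family k H c) \<gamma> gradf \<rho>s = \<rho>s) \<and>
         (T_MD (lin_family k H c) \<gamma> gradf \<rho>s = \<rho>s \<longleftrightarrow> \<Omega> \<rho>s - gradf \<rho>s \<in> normal_subspace k H)"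
proof -
  have \<rho>: "\<rho>s \<in> lin_family k H c" using assms(11) by (simp add: lin_family_pos_def)
  have G: "hermitian (gradf \<rho>s)" using assms(10) \<rho> by (simp add: is_gradient_on_def)
  have \<Omega>: "hermitian (\<Omega> \<rho>s)" using assms(6) \<rho> by (simp add: lin_family_def)
  have "\<Omega> \<rho>s \<in> normal_subspace k H"
    by (rule T_AB_fixed_point_normal[OF assms(11) \<Omega> assms(8,12)])
  \<comment> \<open>Orthogonality to the tangent space is linear, so with
    \<open>\<Omega> \<rho>s\<close> normal, (c3) only tests \<open>gradf \<rho>s\<close>, exactly as
    (c1) and (c2) do.\<close>
  then have "\<Omega> \<rho>s - gradf \<rho>s \<in> normal_subspace k H \<longleftrightarrow> gradf \<rho>s \<in> normal_subspace k H"
    by (simp add: normal_subspace_iff G \<Omega> hermitian_diff mm.diff_right rtrace_simps)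
  then show ?thesis
    using convex_minimizer_iff_gradient_normal[OF assms(11,9,10)]
      T_MD_fixed_point_iff[where G = gradf, OF assms(11) G assms(8)]
    by blast
qed

end
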